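(* Consider the following landing market at a single airport. $A$ is a finite set of flights and $B$ a finite set of landing time-slots. Each slot $s\in B$ has a capacity $c(s)\in\mathbb{Z}^+$. Each flight $i\in A$ has a criticality factor $\alpha_i$ and a landing window $W(i)\subseteq B$, and for each $s\in W(i)$ a delay $d_i(s)$. A landing schedule assigns each flight $i\in A$ to one slot $\sigma(i)\in W(i)$ such that at most $c(s)$ flights are assigned to each slot $s\in B$. Landing prices are numbers $p_s\ge 0$ for $s\in B$. The total cost to flight $i$ of landing in $s$ is $p_s+\alpha_i d_i(s)$. A schedule $\sigma$ together with prices $p$ form an equilibrium landing schedule and prices if: (1) for every flight $i$, $p_{\sigma(i)}+\alpha_i d_i(\sigma(i))=\min_{s\in W(i)}\bigl(p_s+\alpha_i d_i(s)\bigr)$; (2) every slot $s$ to which fewer than $c(s)$ flights are assigned has $p_s=0$. There is a combinatorial, strongly polynomial time algorithm that computes an equilibrium landing schedule and prices for this market.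
   Context: $\alpha_i$ is the dollar value the airline assigns to one unit of delay of flight $i$. $d_i(s)$ is the delay beyond its scheduled arrival time incurred by flight $i$ if it lands in slot $s$. Strongly polynomial means the number of arithmetic operations is polynomial in $|A|$, $|B|$ and the total size of the windows, independent of the magnitudes of the numbers.
   Formalization: The algorithm is required to output an equilibrium only for markets that admit a landing schedule; otherwise (e.g. two flights whose windows are one slot of capacity 1) no equilibrium exists. The polynomial time bound holds for all markets. *)

theory Defs
  imports Complex_Main
begin

section \<open>Landing markets and equilibria\<close>

record ('f, 's) market =
  flights :: "'f set"
  slots :: "'s set"
  capacity :: "'s \<Rightarrow> nat"
  criticality :: "'f \<Rightarrow> real"
  window :: "'f \<Rightarrow> 's set"
  delay :: "'f \<Rightarrow> 's \<Rightarrow> real"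

definition landing_market :: "('f, 's) market \<Rightarrow> bool" where
  "landing_market M \<longleftrightarrow>
     finite (flights M) \<and> finite (slots M) \<and>
     (\<forall>s\<in>slots M. 0 < capacity M s) \<and>
     (\<forall>i\<in>flights M. window M i \<subseteq> slots M)"

definition landing_schedule :: "('f, 's) market \<Rightarrow> ('f \<Rightarrow> 's) \<Rightarrow> bool" where
  "landing_schedule M \<sigma> \<longleftrightarrow>
     (\<forall>i\<in>flights M. \<sigma> i \<in> window M i) \<and>
     (\<forall>s\<in>slots M. card {i\<in>flights M. \<sigma> i = s} \<le> capacity M s)"

definition landing_prices :: "('f, 's) market \<Rightarrow> ('s \<Rightarrow> real) \<Rightarrow> bool" where
  "landing_prices M p \<longleftrightarrow> (\<forall>s\<in>slots M. 0 \<le> p s)"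

definition total_cost :: "('f, 's) market \<Rightarrow> ('s \<Rightarrow> real) \<Rightarrow> 'f \<Rightarrow> 's \<Rightarrow> real" where
  "total_cost M p i s = p s + criticality M i * delay M i s"

definition equilibrium :: "('f, 's) market \<Rightarrow> ('f \<Rightarrow> 's) \<Rightarrow> ('s \<Rightarrow> real) \<Rightarrow> bool" where
  "equilibrium M \<sigma> p \<longleftrightarrow>
     landing_schedule M \<sigma> \<and> landing_prices M p \<and>
     (\<forall>i\<in>flights M. total_cost M p i (\<sigma> i) = Min (total_cost M p i ` window M i)) \<and>
     (\<forall>s\<in>slots M. card {i\<in>flights M. \<sigma> i = s} < capacity M s \<longrightarrow> p s = 0)"

definition market_size :: "('f, 's) market \<Rightarrow> nat" where
  "market_size M = card (flights M) + card (slots M) + (\<Sum>i\<in>flights M. card (window M i))"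


section \<open>Programs over exact real numbers\<close>

text \<open>
  Algorithms are programs of a while language over a random access memory with unit-cost
  operations. There are two sorts of memory cells: index cells hold natural numbers
  and serve for counting and addressing; number cells hold exact real numbers. Memory is
  organised in two-dimensional arrays with string names.

  The real input data sit in a separate read-only memory. Number cells are manipulated only
  by addition, subtraction and comparison, except that two input numbers may be multiplied.
  There are no real constants (which could encode arbitrary information), no rounding, no
  passage from numbers to indices and no multiplication of indices. Hence every number that
  a program computes is an integral linear combination of 1, input numbers and products of
  two input numbers; on rational data, the length of all numbers stays polynomial whenever
  the number of operations is polynomial. This is how the restriction to
  combinatorial algorithms is made precise.
\<close>

datatype iexp =
    IConst nat
  | ICell string iexp iexp
  | IPlus iexp iexp
  | IMinus iexp iexp

datatype nexp =
    NConst int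
  | NCell string iexp iexp
  | NInput string iexp iexp
  | NInputMult string iexp iexp string iexp iexp
  | NPlus nexp nexp
  | NMinus nexp nexp

datatype bexp =
    ILess iexp iexp
  | NLess nexp nexp
  | BNot bexp
  | BAnd bexp bexp

datatype com =
    Skip
  | IAssign string iexp iexp iexp
  | NAssign string iexp iexp nexp
  | Seq com com
  | Cond bexp com com
  | While bexp com

type_synonym 'v memory = "string \<Rightarrow> nat \<Rightarrow> nat \<Rightarrow> 'v"

record state =
  idx :: "nat memory"
  num :: "real memory"

definition store :: "string \<Rightarrow> nat \<Rightarrow> nat \<Rightarrow> 'v \<Rightarrow> 'v memory \<Rightarrow> 'v memory" where
  "store a i j v m = (\<lambda>a' i' j'. if a' = a \<and> i' = i \<and> j' = j then v else m a' i' j')"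

fun ival :: "iexp \<Rightarrow> state \<Rightarrow> nat" where
  "ival (IConst n) s = n"
| "ival (ICell a e1 e2) s = idx s a (ival e1 s) (ival e2 s)"
| "ival (IPlus e1 e2) s = ival e1 s + ival e2 s"
| "ival (IMinus e1 e2) s = ival e1 s - ival e2 s"

fun nval :: "real memory \<Rightarrow> nexp \<Rightarrow> state \<Rightarrow> real" where
  "nval inp (NConst k) s = of_int k"
| "nval inp (NCell a e1 e2) s = num s a (ival e1 s) (ival e2 s)"
| "nval inp (NInput a e1 e2) s = inp a (ival e1 s) (ival e2 s)"
| "nval inp (NInputMult a e1 e2 b e3 e4) s =
     inp a (ival e1 s) (ival e2 s) * inp b (ival e3 s) (ival e4 s)"
| "nval inp (NPlus e1 e2) s = nval inp e1 s + nval inp e2 s"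
| "nval inp (NMinus e1 e2) s = nval inp e1 s - nval inp e2 s"

fun bval :: "real memory \<Rightarrow> bexp \<Rightarrow> state \<Rightarrow> bool" where
  "bval inp (ILess e1 e2) s \<longleftrightarrow> ival e1 s < ival e2 s"
| "bval inp (NLess e1 e2) s \<longleftrightarrow> nval inp e1 s < nval inp e2 s"
| "bval inp (BNot b) s \<longleftrightarrow> \<not> bval inp b s"
| "bval inp (BAnd b1 b2) s \<longleftrightarrow> bval inp b1 s \<and> bval inp b2 s"

text \<open>
  Every constant, memory access, arithmetic operation, comparison and Boolean operation
  costs one unit; so does each executed command and each evaluated loop test.
\<close>

fun icost :: "iexp \<Rightarrow> nat" where
  "icost (IConst n) = 1"
| "icost (ICell a e1 e2) = 1 + icost e1 + icost e2"
| "icost (IPlus e1 e2) = 1 + icost e1 + icost e2"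
| "icost (IMinus e1 e2) = 1 + icost e1 + icost e2"

fun ncost :: "nexp \<Rightarrow> nat" where
  "ncost (NConst k) = 1"
| "ncost (NCell a e1 e2) = 1 + icost e1 + icost e2"
| "ncost (NInput a e1 e2) = 1 + icost e1 + icost e2"
| "ncost (NInputMult a e1 e2 b e3 e4) = 3 + icost e1 + icost e2 + icost e3 + icost e4"
| "ncost (NPlus e1 e2) = 1 + ncost e1 + ncost e2"
| "ncost (NMinus e1 e2) = 1 + ncost e1 + ncost e2"

fun bcost :: "bexp \<Rightarrow> nat" where
  "bcost (ILess e1 e2) = 1 + icost e1 + icost e2"
| "bcost (NLess e1 e2) = 1 + ncost e1 + ncost e2"
| "bcost (BNot b) = 1 + bcost b"
| "bcost (BAnd b1 b2) = 1 + bcost b1 + bcost b2"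

text \<open>
  \<open>exec inp P s t s'\<close>: on input numbers \<open>inp\<close>, program \<open>P\<close> started in state \<open>s\<close> halts in
  state \<open>s'\<close> after \<open>t\<close> operations.
\<close>

inductive exec :: "real memory \<Rightarrow> com \<Rightarrow> state \<Rightarrow> nat \<Rightarrow> state \<Rightarrow> bool" for inp where
  Skip: "exec inp Skip s 1 s"
| IAssign: "exec inp (IAssign a e1 e2 e) s (1 + icost e1 + icost e2 + icost e)
    (s\<lparr>idx := store a (ival e1 s) (ival e2 s) (ival e s) (idx s)\<rparr>)"
| NAssign: "exec inp (NAssign a e1 e2 e) s (1 + icost e1 + icost e2 + ncost e)
    (s\<lparr>num := store a (ival e1 s) (ival e2 s) (nval inp e s) (num s)\<rparr>)"
| Seq: "exec inp P1 s t1 s1 \<Longrightarrow> exec inp P2 s1 t2 s2 \<Longrightarrow> exec inp (Seq P1 P2) s (t1 + t2) s2"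
| CondTrue: "bval inp b s \<Longrightarrow> exec inp P1 s t s' \<Longrightarrow>
    exec inp (Cond b P1 P2) s (1 + bcost b + t) s'"
| CondFalse: "\<not> bval inp b s \<Longrightarrow> exec inp P2 s t s' \<Longrightarrow>
    exec inp (Cond b P1 P2) s (1 + bcost b + t) s'"
| WhileFalse: "\<not> bval inp b s \<Longrightarrow> exec inp (While b P) s (1 + bcost b) s"
| WhileTrue: "bval inp b s \<Longrightarrow> exec inp P s t1 s1 \<Longrightarrow> exec inp (While b P) s1 t2 s2 \<Longrightarrow>
    exec inp (While b P) s (1 + bcost b + t1 + t2) s2"

inductive_cases exec_elims:
  "exec inp Skip s t s'"
  "exec inp (IAssign a e1 e2 e) s t s'"
  "exec inp (NAssign a e1 e2 e) s t s'"
  "exec inp (Seq P1 P2) s t s'"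
  "exec inp (Cond b P1 P2) s t s'"
  "exec inp (While b P) s t s'"

lemma exec_deterministic:
  "exec inp P s t s' \<Longrightarrow> exec inp P s u s'' \<Longrightarrow> u = t \<and> s'' = s'"
proof (induction arbitrary: u s'' rule: exec.induct)
  case (Skip s)
  then show ?case by (rule exec_elims(1)) simp
next
  case (IAssign a e1 e2 e s)
  then show ?case by (rule exec_elims(2)) simp
next
  case (NAssign a e1 e2 e s)
  then show ?case by (rule exec_elims(3)) simp
next
  case (Seq P1 s t1 s1 P2 t2 s2)
  from Seq.prems obtain u1 r u2
    where "exec inp P1 s u1 r" "exec inp P2 r u2 s''" "u = u1 + u2"
    by (rule exec_elims(4))
  with Seq.IH show ?case by metis
next
  case (CondTrue b s P1 t s' P2)
  from CondTrue.prems CondTrue.hyps obtain v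
    where "exec inp P1 s v s''" "u = 1 + bcost b + v"
    by (auto elim: exec_elims(5))
  with CondTrue.IH show ?case by metis
next
  case (CondFalse b s P2 t s' P1)
  from CondFalse.prems CondFalse.hyps obtain v
    where "exec inp P2 s v s''" "u = 1 + bcost b + v"
    by (auto elim: exec_elims(5))
  with CondFalse.IH show ?case by metis
next
  case (WhileFalse b s P)
  from WhileFalse.prems WhileFalse.hyps show ?case
    by (auto elim: exec_elims(6))
next
  case (WhileTrue b s P t1 s1 t2 s2)
  from WhileTrue.prems WhileTrue.hyps(1) obtain u1 r u2
    where "exec inp P s u1 r" "exec inp (While b P) r u2 s''" "u = 1 + bcost b + u1 + u2"
    by (rule_tac exec_elims(6)) auto
  with WhileTrue.IH show ?case by metis
qed


section \<open>Presenting a market to a program\<close>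

text \<open>
  A market is presented through an enumeration \<open>fs\<close> of its flights and \<open>ss\<close> of its slots;
  the program sees only positions in these lists. Delays are provided only inside the
  windows. All cells not mentioned below, scratch space included, start with 0.
\<close>

definition enumeration :: "'a set \<Rightarrow> 'a list \<Rightarrow> bool" where
  "enumeration A xs \<longleftrightarrow> distinct xs \<and> set xs = A"

definition input_numbers ::
    "('f, 's) market \<Rightarrow> 'f list \<Rightarrow> 's list \<Rightarrow> real memory" where
  "input_numbers M fs ss = (\<lambda>a i j.
     if a = ''criticality'' \<and> i < length fs \<and> j = 0 then criticality M (fs ! i)
     else if a = ''delay'' \<and> i < length fs \<and> j < length ss \<and> ss ! j \<in> window M (fs ! i)
       then delay M (fs ! i) (ss ! j)
     else 0)"

definition input_indices ::
    "('f, 's) market \<Rightarrow> 'f list \<Rightarrow> 's list \<Rightarrow> nat memory" where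
  "input_indices M fs ss = (\<lambda>a i j.
     if a = ''flights'' \<and> i = 0 \<and> j = 0 then length fs
     else if a = ''slots'' \<and> i = 0 \<and> j = 0 then length ss
     else if a = ''capacity'' \<and> i < length ss \<and> j = 0 then capacity M (ss ! i)
     else if a = ''window'' \<and> i < length fs \<and> j < length ss \<and> ss ! j \<in> window M (fs ! i) then 1
     else 0)"

definition initial_state :: "('f, 's) market \<Rightarrow> 'f list \<Rightarrow> 's list \<Rightarrow> state" where
  "initial_state M fs ss = \<lparr>idx = input_indices M fs ss, num = (\<lambda>a i j. 0)\<rparr>"

text \<open>
  Row \<open>i\<close> of \<open>''schedule''\<close> is the position of the slot of the \<open>i\<close>-th flight; row \<open>j\<close> of
  \<open>''price''\<close> is the price of the \<open>j\<close>-th slot. This determines \<open>\<sigma>\<close> on all flights and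
  \<open>p\<close> on all slots.
\<close>

definition outputs ::
    "'f list \<Rightarrow> 's list \<Rightarrow> state \<Rightarrow> ('f \<Rightarrow> 's) \<Rightarrow> ('s \<Rightarrow> real) \<Rightarrow> bool" where
  "outputs fs ss s \<sigma> p \<longleftrightarrow>
     (\<forall>i<length fs. idx s ''schedule'' i 0 < length ss \<and>
                     \<sigma> (fs ! i) = ss ! idx s ''schedule'' i 0) \<and>
     (\<forall>j<length ss. p (ss ! j) = num s ''price'' j 0)"

end

theory Submission
  imports Defs
begin

text \<open>
  The Hungarian method with explicit prices. Flights are added one at a time, keeping an
  equilibrium for the flights seen so far. A new flight first sits in a dummy slot, numbered
  \<open>m\<close>, which is the root of a tree of slots that can be reached by moving flights to slots of the
  same total cost. As long as all slots of the tree are full, their prices are raised by the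
  least amount that makes some edge leaving the tree tight, and the tree grows by the slot at
  its end. If there is no leaving edge, the flights in the tree outnumber the capacity of their
  windows, so no schedule exists. Once the tree contains a slot with spare capacity, each
  flight on the path from this slot back to the root moves one step, at unchanged cost.
  Only scans for a minimal slack are needed, and each new flight takes at most \<open>m + 1\<close> of them.
\<close>

section \<open>Partial equilibria and augmentation\<close>

locale index_market =
  fixes n m :: nat
    and cap :: "nat \<Rightarrow> nat"
    and W :: "nat \<Rightarrow> nat \<Rightarrow> bool"
    and c :: "nat \<Rightarrow> nat \<Rightarrow> real"
  assumes W_less: "W i j \<Longrightarrow> j < m"
begin

definition load :: "nat \<Rightarrow> (nat \<Rightarrow> nat) \<Rightarrow> nat \<Rightarrow> nat" where
  "load k \<sigma> j = card {i. i < k \<and> \<sigma> i = j}"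

definition feasible :: bool where
  "feasible \<longleftrightarrow> (\<exists>\<tau>. (\<forall>i<n. W i (\<tau> i)) \<and> (\<forall>j<m. load n \<tau> j \<le> cap j))"

text \<open>How much dearer slot \<open>j\<close> is for flight \<open>i\<close> than its present
  slot. A flight parked in the dummy slot is compared with \<open>p m + c i m\<close>, so the price
  of the dummy plays the part of the Hungarian potential of the new flight.\<close>

definition slack :: "(nat \<Rightarrow> nat) \<Rightarrow> (nat \<Rightarrow> real) \<Rightarrow> nat \<Rightarrow> nat \<Rightarrow> real" where
  "slack \<sigma> p i j = (p j + c i j) - (p (\<sigma> i) + c i (\<sigma> i))"

text \<open>The loads are an explicit array \<open>l\<close> rather than
  \<open>load k \<sigma>\<close>, because during augmentation they run ahead of the schedule. With
  \<open>cap m = 0\<close>, the condition \<open>l m = 0\<close> makes the dummy slot full.\<close>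

definition prices_ok :: "(nat \<Rightarrow> real) \<Rightarrow> (nat \<Rightarrow> nat) \<Rightarrow> bool" where
  "prices_ok p l \<longleftrightarrow>
     l m = 0 \<and> (\<forall>j<m. 0 \<le> p j \<and> l j \<le> cap j \<and> (l j < cap j \<longrightarrow> p j = 0))"

definition partial_equilibrium ::
    "nat \<Rightarrow> (nat \<Rightarrow> nat) \<Rightarrow> (nat \<Rightarrow> real) \<Rightarrow> (nat \<Rightarrow> nat) \<Rightarrow> bool" where
  "partial_equilibrium k \<sigma> p l \<longleftrightarrow>
     prices_ok p l \<and> (\<forall>i<k. W i (\<sigma> i)) \<and> (\<forall>j<m. l j = load k \<sigma> j) \<and>
     (\<forall>i<k. \<forall>j. W i j \<longrightarrow> 0 \<le> slack \<sigma> p i j)"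

text \<open>
  The tree is encoded by ranks: \<open>r j\<close> is positive iff slot \<open>j\<close> has been reached, and then it is the
  time of its discovery; \<open>\<pi> j\<close> is the flight through which it was reached.
\<close>

definition tree_edge ::
    "nat \<Rightarrow> (nat \<Rightarrow> nat) \<Rightarrow> (nat \<Rightarrow> real) \<Rightarrow> (nat \<Rightarrow> nat) \<Rightarrow> nat \<Rightarrow> nat \<Rightarrow> bool" where
  "tree_edge k \<sigma> p r i j \<longleftrightarrow>
     i \<le> k \<and> W i j \<and> 0 < r (\<sigma> i) \<and> r (\<sigma> i) < r j \<and> slack \<sigma> p i j = 0"

text \<open>
  \<open>t\<close> is the slot reached last and \<open>q\<close> the number of slots reached. While only the dummy slot
  has been reached (\<open>t = m\<close>), its price is a leftover of earlier rounds and flight \<open>k\<close> may have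
  negative slack; the first price change repairs this.
\<close>

definition search ::
    "nat \<Rightarrow> (nat \<Rightarrow> nat) \<Rightarrow> (nat \<Rightarrow> real) \<Rightarrow> (nat \<Rightarrow> nat) \<Rightarrow> (nat \<Rightarrow> nat) \<Rightarrow> (nat \<Rightarrow> nat) \<Rightarrow>
     nat \<Rightarrow> nat \<Rightarrow> bool" where
  "search k \<sigma> p l r \<pi> t q \<longleftrightarrow>
     prices_ok p l \<and> (\<forall>i<k. W i (\<sigma> i)) \<and> \<sigma> k = m \<and> (\<forall>j<m. l j = load k \<sigma> j) \<and>
     (\<forall>i\<le>k. \<forall>j. W i j \<longrightarrow> i < k \<or> t \<noteq> m \<longrightarrow> 0 \<le> slack \<sigma> p i j) \<and>
     t \<le> m \<and> 0 < r t \<and> 0 < r m \<and>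
     (\<forall>j. 0 < r j \<longrightarrow> j \<le> m \<and> (t = m \<longrightarrow> j = m)) \<and>
     (\<forall>j. r j \<le> q) \<and> q + card {j. j < m \<and> r j = 0} = Suc m \<and>
     (\<forall>j<m. 0 < r j \<longrightarrow> (j = t \<or> l j = cap j) \<and> tree_edge k \<sigma> p r (\<pi> j) j)"

text \<open>
  \<open>l\<close> already counts the additional flight that slot \<open>t\<close> is about to receive. Edges of rank above
  \<open>r t\<close> may have been destroyed by moves already made and are not needed any more.
\<close>

definition augmenting ::
    "nat \<Rightarrow> (nat \<Rightarrow> nat) \<Rightarrow> (nat \<Rightarrow> real) \<Rightarrow> (nat \<Rightarrow> nat) \<Rightarrow> (nat \<Rightarrow> nat) \<Rightarrow> (nat \<Rightarrow> nat) \<Rightarrow>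
     nat \<Rightarrow> bool" where
  "augmenting k \<sigma> p l r \<pi> t \<longleftrightarrow>
     prices_ok p l \<and> (\<forall>i\<le>k. W i (\<sigma> i) \<or> \<sigma> i = m \<and> i = k \<and> t \<noteq> m) \<and>
     (\<forall>j<m. l j = load (Suc k) \<sigma> j + (if j = t then 1 else 0)) \<and>
     (\<forall>i\<le>k. \<forall>j. W i j \<longrightarrow> 0 \<le> slack \<sigma> p i j) \<and>
     t \<le> m \<and> 0 < r t \<and> (\<forall>j. 0 < r j \<longrightarrow> j \<le> m) \<and>
     (\<forall>j<m. 0 < r j \<longrightarrow> r j \<le> r t \<longrightarrow> tree_edge k \<sigma> p r (\<pi> j) j)"

text \<open>The edges that cross the cut from the tree to the slots not yet reached.\<close>

definition candidates :: "nat \<Rightarrow> (nat \<Rightarrow> nat) \<Rightarrow> (nat \<Rightarrow> nat) \<Rightarrow> (nat \<times> nat) set" where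
  "candidates k \<sigma> r = {(i, j). i \<le> k \<and> 0 < r (\<sigma> i) \<and> W i j \<and> r j = 0}"

section \<open>Counting the flights in slots\<close>

lemma load_Suc: "load (Suc k) \<sigma> j = load k \<sigma> j + (if \<sigma> k = j then 1 else 0)"
proof -
  have "{i. i < Suc k \<and> \<sigma> i = j} = (if \<sigma> k = j then insert k {i. i < k \<and> \<sigma> i = j} else {i. i < k \<and> \<sigma> i = j})"
    by (auto simp: less_Suc_eq)
  then show ?thesis by (auto simp: load_def)
qed

lemma load_cong: "(\<And>i. i < k \<Longrightarrow> \<sigma> i = \<tau> i) \<Longrightarrow> load k \<sigma> j = load k \<tau> j"
  unfolding load_def by (rule arg_cong[where f=card]) auto

text \<open>A unit is added on both sides so that no truncated subtraction of naturals occurs; this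
  is also the form in which \<open>augmenting\<close> records the pending unit at
  \<open>t\<close>.\<close>

lemma load_move:
  assumes "i < k" "\<sigma> i \<noteq> t"
  shows "load k (\<sigma>(i := t)) j + (if j = \<sigma> i then 1 else 0) = load k \<sigma> j + (if j = t then 1 else 0)"
proof -
  have A: "{x. x < k \<and> (\<sigma>(i := t)) x = j} = (if j = t then insert i ({x. x < k \<and> \<sigma> x = j} - {i}) else {x. x < k \<and> \<sigma> x = j} - {i})"
    using assms by auto
  have "i \<in> {x. x < k \<and> \<sigma> x = \<sigma> i}" using assms by auto
  then have "card {x. x < k \<and> \<sigma> x = \<sigma> i} = Suc (card ({x. x < k \<and> \<sigma> x = \<sigma> i} - {i}))"
    by (intro card.remove) auto
  moreover have "{x. x < k \<and> \<sigma> x = j} - {i} = {x. x < k \<and> \<sigma> x = j}" if "j \<noteq> \<sigma> i" using that by auto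
  ultimately show ?thesis using assms unfolding load_def A by auto
qed

lemma sum_load: "finite T \<Longrightarrow> sum (load k \<sigma>) T = card {i. i < k \<and> \<sigma> i \<in> T}"
proof -
  assume "finite T"
  then have "card (\<Union>j\<in>T. {i. i < k \<and> \<sigma> i = j}) = (\<Sum>j\<in>T. card {i. i < k \<and> \<sigma> i = j})"
    by (intro card_UN_disjoint) auto
  moreover have "(\<Union>j\<in>T. {i. i < k \<and> \<sigma> i = j}) = {i. i < k \<and> \<sigma> i \<in> T}" by auto
  ultimately show ?thesis by (simp add: load_def)
qed

section \<open>Growing the tree\<close>

lemma partial_equilibrium_0: "(\<And>j. p j = 0) \<Longrightarrow> (\<And>j. l j = 0) \<Longrightarrow> partial_equilibrium 0 \<sigma> p l"
  by (auto simp: partial_equilibrium_def prices_ok_def load_def)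

lemma search_init:
  assumes "partial_equilibrium k \<sigma> p l"
  shows "search k (\<sigma>(k := m)) p l ((\<lambda>_. 0)(m := 1)) \<pi> m 1"
proof -
  have "load k (\<sigma>(k := m)) j = load k \<sigma> j" for j by (rule load_cong) auto
  moreover have "{j. j < m \<and> ((\<lambda>_. 0)(m := 1)) j = (0::nat)} = {..<m}" by auto
  ultimately show ?thesis using assms
    by (auto simp: search_def partial_equilibrium_def slack_def)
qed

text \<open>Raising all tree prices by the least crossing slack leaves slacks inside the tree alone,
  keeps crossing slacks nonnegative by minimality, makes the chosen edge tight, and can only help
  flights outside. The raised real slots are full, so idle slots keep price 0. In the first round
  the amount may be negative, but then only the dummy is reached, whose price is
  unconstrained.\<close>

lemma search_step:
  assumes S: "search k \<sigma> p l r \<pi> t q" and full: "\<not> l t < cap t"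
    and cand: "(i, j) \<in> candidates k \<sigma> r"
    and least: "\<And>i' j'. (i', j') \<in> candidates k \<sigma> r \<Longrightarrow> slack \<sigma> p i j \<le> slack \<sigma> p i' j'"
    and p': "\<And>s. p' s = (if 0 < r s then p s + slack \<sigma> p i j else p s)"
  shows "search k \<sigma> p' l (r(j := Suc q)) (\<pi>(j := i)) j (Suc q)"
proof -
  let ?d = "slack \<sigma> p i j"
  from cand have c: "i \<le> k" "0 < r (\<sigma> i)" "W i j" "r j = 0" by (auto simp: candidates_def)
  have jm: "j < m" using c W_less by auto
  note S' = S[unfolded search_def]
  have pr: "prices_ok p l" using S' by auto
  have opt0: "0 \<le> slack \<sigma> p a b" if "a \<le> k" "W a b" "a < k \<or> t \<noteq> m" for a b
    using S' that by auto
  have rm: "0 < r m" and km: "\<sigma> k = m" and rq: "\<And>b. r b \<le> q" using S' by auto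
  \<comment> \<open>Once a real slot is reached the first round is over, so all slacks are already
    nonnegative.\<close>
  have rt: "t \<noteq> m" if "0 < r b" "b < m" for b using S' that by auto
  have d0: "0 \<le> ?d" if "t \<noteq> m" using opt0 that c by auto
  \<comment> \<open>Reached slots other than \<open>t\<close> are full by the invariant, and
    \<open>t\<close> by \<open>full\<close>.\<close>
  have fullT: "l s = cap s" if "s < m" "0 < r s" for s
    using S' that full unfolding prices_ok_def by (metis le_neq_implies_less)
  \<comment> \<open>Only edges with exactly one end in the tree change their slack.\<close>
  have slack': "slack \<sigma> p' a b = slack \<sigma> p a b + (if 0 < r b then ?d else 0) - (if 0 < r (\<sigma> a) then ?d else 0)" for a b
    by (auto simp: slack_def p')
  have po: "prices_ok p' l"
    unfolding prices_ok_def
  proof (intro conjI allI impI)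
    show "l m = 0" using pr by (auto simp: prices_ok_def)
    fix s assume s: "s < m"
    show "l s \<le> cap s" using pr s by (auto simp: prices_ok_def)
    have "0 \<le> p s" using pr s by (auto simp: prices_ok_def)
    then show "0 \<le> p' s" using d0 rt[of s] s by (auto simp: p')
    assume l: "l s < cap s"
    then have "p s = 0" using pr s by (auto simp: prices_ok_def)
    moreover have "\<not> 0 < r s" using fullT[of s] s l by auto
    ultimately show "p' s = 0" by (auto simp: p')
  qed
  have opt: "0 \<le> slack \<sigma> p' a b" if a: "a \<le> k" and W: "W a b" for a b
  proof (cases "0 < r (\<sigma> a)")
    case True
    show ?thesis
    proof (cases "0 < r b")
      case True
      then have "t \<noteq> m" using rt W_less[OF W] by auto
      then show ?thesis using opt0 a W True \<open>0 < r (\<sigma> a)\<close> by (auto simp: slack')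
    next
      case False
      then show ?thesis using least[of a b] True a W by (auto simp: slack' candidates_def)
    qed
  next
    case False
    \<comment> \<open>Flight \<open>k\<close> sits in the dummy, which is reached, so a flight
      outside the tree is an old one.\<close>
    then have "a < k" using rm km a by (metis le_neq_implies_less)
    then have "0 \<le> slack \<sigma> p a b" using opt0 W by auto
    moreover have "0 < r b \<Longrightarrow> 0 \<le> ?d" using d0 rt W_less[OF W] by auto
    ultimately show ?thesis using False by (auto simp: slack')
  qed
  have rj: "\<And>b. 0 < r b \<Longrightarrow> b \<noteq> j" using c by auto
  have te: "tree_edge k \<sigma> p' (r(j := Suc q)) ((\<pi>(j := i)) s) s" if "s < m" "0 < (r(j := Suc q)) s" for s
  proof (cases "s = j")
    case True
    \<comment> \<open>The new edge has slack \<open>?d - ?d = 0\<close>, and \<open>Suc q\<close>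
      exceeds every earlier rank.\<close>
    then show ?thesis using c rj rq by (auto simp: tree_edge_def slack' less_Suc_eq_le)
  next
    case False
    \<comment> \<open>Both ends of an old edge are in the tree, so the price change cancels.\<close>
    then have "tree_edge k \<sigma> p r (\<pi> s) s" using that S' by auto
    then show ?thesis using False that rj by (auto simp: tree_edge_def slack')
  qed
  have "{b. b < m \<and> r b = 0} = insert j {b. b < m \<and> (r(j := Suc q)) b = 0}" using jm c by auto
  then have "card {b. b < m \<and> r b = 0} = Suc (card {b. b < m \<and> (r(j := Suc q)) b = 0})"
    by (simp add: card_insert_if)
  then have cnt: "Suc q + card {b. b < m \<and> (r(j := Suc q)) b = 0} = Suc m" using S' by auto
  have "\<forall>i<k. W i (\<sigma> i)" "\<forall>j<m. l j = load k \<sigma> j" "\<And>b. 0 < r b \<Longrightarrow> b \<le> m" using S' by auto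
  then show ?thesis
    unfolding search_def
    using po opt te cnt jm km rm rq fullT by (auto intro: le_SucI)
qed

text \<open>A violation of Hall's condition: the flights of \<open>F\<close> fill the reached real
  slots \<open>T\<close> exactly, and \<open>k\<close> is one flight more, yet the windows of all of
  them lie inside \<open>T\<close>.\<close>

lemma search_no_candidates:
  assumes S: "search k \<sigma> p l r \<pi> t q" and full: "\<not> l t < cap t" and k: "k < n"
    and none: "candidates k \<sigma> r = {}"
  shows "\<not> feasible"
proof
  assume feasible
  then obtain \<tau> where \<tau>: "\<forall>i<n. W i (\<tau> i)" "\<forall>j<m. load n \<tau> j \<le> cap j"
    by (auto simp: feasible_def)
  note S' = S[unfolded search_def]
  define T where "T = {j. j < m \<and> 0 < r j}"
  define F where "F = {i. i < k \<and> \<sigma> i \<in> T}"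
  have T: "finite T" by (auto simp: T_def)
  have fullT: "cap s = load k \<sigma> s" if "s \<in> T" for s
    using S' that full unfolding prices_ok_def T_def by (metis (mono_tags, lifting) le_neq_implies_less mem_Collect_eq)
  have rm: "0 < r m" and km: "\<sigma> k = m" using S' by auto
  have "\<tau> i \<in> T" if "i \<in> insert k F" for i
  proof -
    have i: "i \<le> k" "0 < r (\<sigma> i)" using that rm km by (auto simp: F_def T_def)
    then have "W i (\<tau> i)" using \<tau> k by auto
    moreover have "(i, \<tau> i) \<notin> candidates k \<sigma> r" using none by simp
    ultimately show ?thesis using i W_less by (auto simp: candidates_def T_def)
  qed
  then have "insert k F \<subseteq> {i. i < n \<and> \<tau> i \<in> T}" using k by (auto simp: F_def)
  then have "card (insert k F) \<le> card {i. i < n \<and> \<tau> i \<in> T}" by (intro card_mono) auto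
  also have "\<dots> = sum (load n \<tau>) T" using T by (simp add: sum_load)
  also have "\<dots> \<le> sum cap T" using \<tau> by (intro sum_mono) (auto simp: T_def)
  also have "\<dots> = sum (load k \<sigma>) T" using fullT by (intro sum.cong) auto
  also have "\<dots> = card F" using T by (simp add: sum_load F_def)
  finally show False by (auto simp: F_def)
qed

section \<open>Moving flights along the path to the root\<close>

lemma augmenting_init:
  assumes S: "search k \<sigma> p l r \<pi> t q" and room: "l t < cap t" and "cap m = 0"
  shows "augmenting k \<sigma> p (l(t := Suc (l t))) r \<pi> t"
proof -
  note S' = S[unfolded search_def]
  \<comment> \<open>The dummy has capacity 0 and thus no room, so a slot with room is a real
    one.\<close>
  have tm: "t < m" using S' assms by (metis le_neq_implies_less not_less0)
  have "prices_ok p (l(t := Suc (l t)))" using S' tm room by (auto simp: prices_ok_def)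
  moreover have "W i (\<sigma> i) \<or> \<sigma> i = m \<and> i = k \<and> t \<noteq> m" if "i \<le> k" for i
    using S' tm that by (cases "i = k") auto
  ultimately show ?thesis using S' tm by (auto simp: augmenting_def load_Suc)
qed

text \<open>The edge to \<open>t\<close> is tight, so the move alters no slack. The vacated slot
  becomes the one that awaits a flight, and its smaller rank ensures termination.\<close>

lemma augmenting_step:
  assumes A: "augmenting k \<sigma> p l r \<pi> t" and t: "t < m"
  shows "augmenting k (\<sigma>(\<pi> t := t)) p l r \<pi> (\<sigma> (\<pi> t)) \<and> r (\<sigma> (\<pi> t)) < r t"
proof -
  note A' = A[unfolded augmenting_def]
  let ?i = "\<pi> t" and ?\<sigma> = "\<sigma>(\<pi> t := t)"
  have e: "?i \<le> k" "W ?i t" "0 < r (\<sigma> ?i)" "r (\<sigma> ?i) < r t" "slack \<sigma> p ?i t = 0"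
    using A' t unfolding tree_edge_def by auto
  have slack': "slack ?\<sigma> p a b = slack \<sigma> p a b" for a b
    using e(5) by (auto simp: slack_def)
  have "load (Suc k) ?\<sigma> j + (if j = \<sigma> ?i then 1 else 0) = load (Suc k) \<sigma> j + (if j = t then 1 else 0)" for j
    using e by (intro load_move) auto
  moreover have "tree_edge k ?\<sigma> p r (\<pi> j) j" if "j < m" "0 < r j" "r j \<le> r (\<sigma> ?i)" for j
  proof -
    have "tree_edge k \<sigma> p r (\<pi> j) j" using A' that e by auto
    \<comment> \<open>Were \<open>\<pi> j\<close> the moved flight, the rank of its old slot would
      lie strictly below \<open>r j\<close>, which is at most that same rank.\<close>
    moreover then have "\<pi> j \<noteq> ?i" using that by (auto simp: tree_edge_def)
    ultimately show ?thesis by (auto simp: tree_edge_def slack')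
  qed
  \<comment> \<open>Only flight \<open>k\<close> can be in the dummy, so the path reaches the dummy
    exactly when \<open>k\<close> moves out.\<close>
  moreover have "\<sigma> (\<pi> t) \<noteq> m" if "\<sigma> k = m" "k \<noteq> \<pi> t"
    using A' e W_less that by (metis less_irrefl)
  ultimately show ?thesis using A' e t
    by (auto simp: augmenting_def slack')
qed

text \<open>At \<open>t = m\<close> the pending unit has passed to the dummy, so the loads of all
  real slots are exact and flight \<open>k\<close> has entered its window.\<close>

lemma augmenting_finish:
  assumes "augmenting k \<sigma> p l r \<pi> t" "\<not> t < m"
  shows "partial_equilibrium (Suc k) \<sigma> p l"
  using assms by (auto simp: augmenting_def partial_equilibrium_def less_Suc_eq_le)

end

section \<open>Total correctness with time bounds\<close>

text \<open>The running time if every loop makes at most \<open>N\<close> iterations each time it is entered.\<close>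

fun time_bound :: "nat \<Rightarrow> com \<Rightarrow> nat" where
  "time_bound N Skip = 1"
| "time_bound N (IAssign a e1 e2 e) = 1 + icost e1 + icost e2 + icost e"
| "time_bound N (NAssign a e1 e2 e) = 1 + icost e1 + icost e2 + ncost e"
| "time_bound N (Seq P1 P2) = time_bound N P1 + time_bound N P2"
| "time_bound N (Cond b P1 P2) = 1 + bcost b + time_bound N P1 + time_bound N P2"
| "time_bound N (While b P) = (N + 1) * (1 + bcost b + time_bound N P)"

text \<open>\<open>C\<close> and \<open>k\<close> depend on the program text alone. Composition adds
  the exponents, a crude common bound, and each loop raises the exponent by one.\<close>

lemma time_bound_polynomial: "\<exists>C k. \<forall>N. time_bound N P \<le> C * (N + 1) ^ k"
proof (induction P)
  case Skip
  show ?case by (intro exI[of _ 1] exI[of _ 0]) simp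
next
  case (IAssign a e1 e2 e)
  show ?case by (intro exI[of _ "1 + icost e1 + icost e2 + icost e"] exI[of _ 0]) simp
next
  case (NAssign a e1 e2 e)
  show ?case by (intro exI[of _ "1 + icost e1 + icost e2 + ncost e"] exI[of _ 0]) simp
next
  case (Seq P1 P2)
  then obtain C1 k1 C2 k2 where *: "\<And>N. time_bound N P1 \<le> C1 * (N + 1) ^ k1" "\<And>N. time_bound N P2 \<le> C2 * (N + 1) ^ k2"
    by blast
  have "time_bound N (Seq P1 P2) \<le> (C1 + C2) * (N + 1) ^ (k1 + k2)" for N
  proof -
    have "(N + 1) ^ k1 \<le> (N + 1) ^ (k1 + k2)" "(N + 1) ^ k2 \<le> (N + 1) ^ (k1 + k2)"
      by (auto intro: power_increasing)
    then have "C1 * (N + 1) ^ k1 \<le> C1 * (N + 1) ^ (k1 + k2)" "C2 * (N + 1) ^ k2 \<le> C2 * (N + 1) ^ (k1 + k2)"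
      by (auto intro: mult_le_mono2)
    with *[of N] show ?thesis unfolding time_bound.simps distrib_right by linarith
  qed
  then show ?case by blast
next
  case (Cond b P1 P2)
  then obtain C1 k1 C2 k2 where *: "\<And>N. time_bound N P1 \<le> C1 * (N + 1) ^ k1" "\<And>N. time_bound N P2 \<le> C2 * (N + 1) ^ k2"
    by blast
  have "time_bound N (Cond b P1 P2) \<le> (1 + bcost b + C1 + C2) * (N + 1) ^ (k1 + k2)" for N
  proof -
    have "(N + 1) ^ k1 \<le> (N + 1) ^ (k1 + k2)" "(N + 1) ^ k2 \<le> (N + 1) ^ (k1 + k2)"
      by (auto intro: power_increasing)
    then have "C1 * (N + 1) ^ k1 \<le> C1 * (N + 1) ^ (k1 + k2)" "C2 * (N + 1) ^ k2 \<le> C2 * (N + 1) ^ (k1 + k2)"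
      by (auto intro: mult_le_mono2)
    moreover have "(1 + bcost b) * 1 \<le> (1 + bcost b) * (N + 1) ^ (k1 + k2)"
      by (intro mult_le_mono2) simp
    ultimately show ?thesis using *[of N] unfolding time_bound.simps distrib_right by linarith
  qed
  then show ?case by blast
next
  case (While b P)
  then obtain C k where *: "\<And>N. time_bound N P \<le> C * (N + 1) ^ k" by blast
  have "time_bound N (While b P) \<le> (1 + bcost b + C) * (N + 1) ^ Suc k" for N
  proof -
    have "(1 + bcost b) * 1 \<le> (1 + bcost b) * (N + 1) ^ k" by (intro mult_le_mono2) simp
    then have "1 + bcost b + time_bound N P \<le> (1 + bcost b + C) * (N + 1) ^ k"
      using *[of N] by (simp add: distrib_right)
    then have "(N + 1) * (1 + bcost b + time_bound N P) \<le> (N + 1) * ((1 + bcost b + C) * (N + 1) ^ k)"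
      by (rule mult_le_mono2)
    then show ?thesis by (simp add: algebra_simps)
  qed
  then show ?case by blast
qed

text \<open>Total correctness together with the static time bound: halting, cost and postcondition
  are established in one pass.\<close>

definition wp :: "real memory \<Rightarrow> nat \<Rightarrow> com \<Rightarrow> (state \<Rightarrow> bool) \<Rightarrow> state \<Rightarrow> bool" where
  "wp inp N P Q s \<longleftrightarrow> (\<exists>t s'. exec inp P s t s' \<and> t \<le> time_bound N P \<and> Q s')"

lemma wp_Skip: "Q s \<Longrightarrow> wp inp N Skip Q s"
  unfolding wp_def by (force intro: exec.Skip)

lemma wp_IAssign:
  "Q (s\<lparr>idx := store a (ival e1 s) (ival e2 s) (ival e s) (idx s)\<rparr>) \<Longrightarrow> wp inp N (IAssign a e1 e2 e) Q s"
  unfolding wp_def by (force intro: exec.IAssign)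

lemma wp_NAssign:
  "Q (s\<lparr>num := store a (ival e1 s) (ival e2 s) (nval inp e s) (num s)\<rparr>) \<Longrightarrow> wp inp N (NAssign a e1 e2 e) Q s"
  unfolding wp_def by (force intro: exec.NAssign)

lemma wp_Seq: "wp inp N P1 (wp inp N P2 Q) s \<Longrightarrow> wp inp N (Seq P1 P2) Q s"
  unfolding wp_def by (force intro: exec.Seq add_mono)

lemma wp_Cond:
  assumes "bval inp b s \<Longrightarrow> wp inp N P1 Q s" "\<not> bval inp b s \<Longrightarrow> wp inp N P2 Q s"
  shows "wp inp N (Cond b P1 P2) Q s"
proof (cases "bval inp b s")
  case True
  with assms obtain t s' where "exec inp P1 s t s'" "t \<le> time_bound N P1" "Q s'" by (auto simp: wp_def)
  with True show ?thesis unfolding wp_def by (force intro: exec.CondTrue)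
next
  case False
  with assms obtain t s' where "exec inp P2 s t s'" "t \<le> time_bound N P2" "Q s'" by (auto simp: wp_def)
  with False show ?thesis unfolding wp_def by (force intro: exec.CondFalse)
qed

lemma wp_mono: "wp inp N P R s \<Longrightarrow> (\<And>s'. R s' \<Longrightarrow> Q s') \<Longrightarrow> wp inp N P Q s"
  unfolding wp_def by blast

text \<open>A variant that is at most \<open>N\<close> on entry and strictly decreases allows at
  most \<open>N\<close> iterations; the extra factor in \<open>N + 1\<close> pays for the last,
  failing test.\<close>

lemma wp_While:
  fixes \<mu> :: "state \<Rightarrow> nat"
  assumes init: "I s" "\<mu> s \<le> N"
    and step: "\<And>s. I s \<Longrightarrow> bval inp b s \<Longrightarrow> wp inp N P (\<lambda>s'. I s' \<and> \<mu> s' < \<mu> s) s"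
    and finish: "\<And>s. I s \<Longrightarrow> \<not> bval inp b s \<Longrightarrow> Q s"
  shows "wp inp N (While b P) Q s"
proof -
  let ?B = "1 + bcost b + time_bound N P"
  have "\<exists>t s'. exec inp (While b P) s t s' \<and> t \<le> (d + 1) * ?B \<and> Q s'" if "I s" "\<mu> s \<le> d" for d s
    using that
  proof (induction d arbitrary: s)
    case 0
    \<comment> \<open>At variant 0 the test must fail, since the body would push the variant below
      0.\<close>
    then have "\<not> bval inp b s" using step[of s] by (auto simp: wp_def)
    then show ?case using finish[OF 0(1)] by (force intro: exec.WhileFalse)
  next
    case (Suc d)
    show ?case
    proof (cases "bval inp b s")
      case True
      with step[OF Suc(2)] obtain t1 s1 where 1: "exec inp P s t1 s1" "t1 \<le> time_bound N P" "I s1" "\<mu> s1 < \<mu> s"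
        by (auto simp: wp_def)
      with Suc obtain t2 s2 where 2: "exec inp (While b P) s1 t2 s2" "t2 \<le> (d + 1) * ?B" "Q s2"
        by (meson less_Suc_eq_le order_less_le_trans)
      have "exec inp (While b P) s (1 + bcost b + t1 + t2) s2" using True 1 2 by (intro exec.WhileTrue)
      moreover have "1 + bcost b + t1 + t2 \<le> (Suc d + 1) * ?B" using 1 2 by simp
      ultimately show ?thesis using 2 by blast
    next
      case False
      then have "exec inp (While b P) s (1 + bcost b) s" by (rule exec.WhileFalse)
      moreover have "1 + bcost b \<le> (Suc d + 1) * ?B" by simp
      ultimately show ?thesis using finish[OF Suc(2) False] by blast
    qed
  qed
  from this[OF init] show ?thesis by (simp add: wp_def)
qed

section \<open>Evaluating stores, and frame conditions\<close>

lemma store_apply: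
  "store a i j v \<mu> b = (if b = a then (\<mu> a)(i := (\<mu> a i)(j := v)) else \<mu> b)"
  by (auto simp: store_def fun_eq_iff)

text \<open>A frame condition: \<open>A\<close> and \<open>B\<close> name the index and number
  arrays that may have changed.\<close>

definition agree :: "string set \<Rightarrow> string set \<Rightarrow> state \<Rightarrow> state \<Rightarrow> bool" where
  "agree A B s s' \<longleftrightarrow> (\<forall>a. a \<notin> A \<longrightarrow> idx s' a = idx s a) \<and> (\<forall>a. a \<notin> B \<longrightarrow> num s' a = num s a)"

lemma agree_refl: "agree A B s s"
  by (simp add: agree_def)

lemma agree_trans:
  "agree A B s s' \<Longrightarrow> agree A' B' s' s'' \<Longrightarrow> A \<union> A' \<subseteq> C \<Longrightarrow> B \<union> B' \<subseteq> D \<Longrightarrow> agree C D s s''"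
  unfolding agree_def by (metis UnCI subsetD)

lemma idx_id: "s\<lparr>idx := idx s\<rparr> = s" and num_id: "s\<lparr>num := num s\<rparr> = s"
  by simp_all

text \<open>Used as rewrite rules, these peel off stores to arrays that may change, until
  \<open>idx_id\<close> or \<open>num_id\<close> restores the plain state.\<close>

lemma agree_store_idx:
  "a \<in> A \<Longrightarrow> agree A B s (s'\<lparr>idx := store a i j v \<mu>\<rparr>) \<longleftrightarrow> agree A B s (s'\<lparr>idx := \<mu>\<rparr>)"
  by (auto simp: agree_def store_apply)

lemma agree_store_num:
  "a \<in> B \<Longrightarrow> agree A B s (s'\<lparr>num := store a i j v \<mu>\<rparr>) \<longleftrightarrow> agree A B s (s'\<lparr>num := \<mu>\<rparr>)"
  by (auto simp: agree_def store_apply)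

lemmas agree_store = agree_refl agree_store_idx agree_store_num idx_id num_id

section \<open>The program and its correctness\<close>

abbreviation iget :: "string \<Rightarrow> iexp" where "iget x \<equiv> ICell x (IConst 0) (IConst 0)"
abbreviation nget :: "string \<Rightarrow> nexp" where "nget x \<equiv> NCell x (IConst 0) (IConst 0)"
abbreviation iput :: "string \<Rightarrow> iexp \<Rightarrow> com" where "iput x \<equiv> IAssign x (IConst 0) (IConst 0)"
abbreviation nput :: "string \<Rightarrow> nexp \<Rightarrow> com" where "nput x \<equiv> NAssign x (IConst 0) (IConst 0)"
abbreviation row :: "string \<Rightarrow> iexp \<Rightarrow> iexp" where "row x e \<equiv> ICell x e (IConst 0)"
abbreviation ipos :: "iexp \<Rightarrow> bexp" where "ipos e \<equiv> ILess (IConst 0) e"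
abbreviation incr :: "string \<Rightarrow> com" where "incr x \<equiv> iput x (IPlus (iget x) (IConst 1))"

section \<open>The program text\<close>

definition cost_exp :: "iexp \<Rightarrow> iexp \<Rightarrow> nexp" where
  "cost_exp i j = NPlus (NCell ''price'' j (IConst 0)) (NInputMult ''criticality'' i (IConst 0) ''delay'' i j)"

text \<open>The flag \<open>found\<close> replaces an initial best value of infinity. On equal
  slacks the earlier candidate is kept.\<close>

definition scan_cell :: com where
  "scan_cell =
     Cond (BAnd (ipos (ICell ''window'' (iget ''i'') (iget ''j'')))
                (BNot (ipos (ICell ''rank'' (iget ''k'') (iget ''j'')))))
       (Seq (nput ''value'' (NMinus (cost_exp (iget ''i'') (iget ''j''))
                                     (cost_exp (iget ''i'') (row ''schedule'' (iget ''i'')))))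
       (Cond (BAnd (ipos (iget ''found'')) (BNot (NLess (nget ''value'') (nget ''best''))))
          Skip
          (Seq (iput ''found'' (IConst 1))
          (Seq (nput ''best'' (nget ''value''))
          (Seq (iput ''best_i'' (iget ''i''))
               (iput ''best_j'' (iget ''j'')))))))
       Skip"

definition scan_row :: com where
  "scan_row =
     Seq (iput ''j'' (IConst 0))
         (While (ILess (iget ''j'') (iget ''slots'')) (Seq scan_cell (incr ''j'')))"

definition scan :: com where
  "scan =
     Seq (iput ''found'' (IConst 0))
     (Seq (iput ''i'' (IConst 0))
     (While (ILess (iget ''i'') (IPlus (iget ''k'') (IConst 1)))
       (Seq (Cond (ipos (ICell ''rank'' (iget ''k'') (row ''schedule'' (iget ''i'')))) scan_row Skip)
            (incr ''i''))))"

text \<open>The loop includes index \<open>m\<close>, because the dummy belongs to the tree and its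
  price must move as well.\<close>

definition raise_prices :: com where
  "raise_prices =
     Seq (iput ''j'' (IConst 0))
     (While (ILess (iget ''j'') (IPlus (iget ''slots'') (IConst 1)))
       (Seq (Cond (ipos (ICell ''rank'' (iget ''k'') (iget ''j'')))
               (NAssign ''price'' (iget ''j'') (IConst 0)
                  (NPlus (NCell ''price'' (iget ''j'') (IConst 0)) (nget ''best'')))
               Skip)
            (incr ''j'')))"

definition extend_tree :: com where
  "extend_tree =
     Seq raise_prices
     (Seq (incr ''q'')
     (Seq (IAssign ''rank'' (iget ''k'') (iget ''best_j'') (iget ''q''))
     (Seq (IAssign ''parent'' (iget ''k'') (iget ''best_j'') (iget ''best_i''))
          (iput ''t'' (iget ''best_j'')))))"

text \<open>The dummy slot has load 0 and, since it lies outside the input, capacity 0; so it counts as full.\<close>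

definition grow_tree :: com where
  "grow_tree =
     While (BAnd (BNot (ipos (iget ''fail'')))
                 (BNot (ILess (row ''load'' (iget ''t'')) (row ''capacity'' (iget ''t'')))))
       (Seq scan
       (Cond (ipos (iget ''found''))
          extend_tree
          (iput ''fail'' (IConst 1))))"

text \<open>Only the load of the end slot grows: every other real slot on the path loses one flight
  and gains one.\<close>

definition augment :: com where
  "augment =
     Seq (IAssign ''load'' (iget ''t'') (IConst 0) (IPlus (row ''load'' (iget ''t'')) (IConst 1)))
     (While (ILess (iget ''t'') (iget ''slots''))
       (Seq (iput ''i'' (ICell ''parent'' (iget ''k'') (iget ''t'')))
       (Seq (iput ''j'' (row ''schedule'' (iget ''i'')))
       (Seq (IAssign ''schedule'' (iget ''i'') (IConst 0) (iget ''t''))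
            (iput ''t'' (iget ''j''))))))"

text \<open>Each flight has its own row \<open>k\<close> of \<open>rank\<close>, which is still zero
  when the flight is added, so the tree of the previous flight never has to be cleared.\<close>

definition add_flight :: com where
  "add_flight =
     Seq (IAssign ''schedule'' (iget ''k'') (IConst 0) (iget ''slots''))
     (Seq (IAssign ''rank'' (iget ''k'') (iget ''slots'') (IConst 1))
     (Seq (iput ''q'' (IConst 1))
     (Seq (iput ''t'' (iget ''slots''))
     (Seq grow_tree
     (Seq (Cond (ipos (iget ''fail'')) Skip augment)
          (incr ''k''))))))"

definition landing_program :: com where
  "landing_program =
     While (BAnd (ILess (iget ''k'') (iget ''flights'')) (BNot (ipos (iget ''fail'')))) add_flight"

abbreviation "k_of s \<equiv> idx s ''k'' 0 0"
abbreviation "schedule_of s \<equiv> (\<lambda>i. idx s ''schedule'' i 0)"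
abbreviation "price_of s \<equiv> (\<lambda>j. num s ''price'' j 0)"
abbreviation "load_of s \<equiv> (\<lambda>j. idx s ''load'' j 0)"
abbreviation "rank_of s \<equiv> idx s ''rank'' (k_of s)"
abbreviation "parent_of s \<equiv> idx s ''parent'' (k_of s)"

lemmas exec_defs = store_apply agree_def cost_exp_def

locale market_program = index_market n m cap W "\<lambda>i j. inp ''criticality'' i 0 * inp ''delay'' i j"
  for n m cap W and inp :: "real memory" +
  fixes N :: nat
  assumes cap_m: "cap m = 0" and N: "n + m < N"
begin

section \<open>Correctness of the scan and of the price change\<close>

definition input_ok :: "state \<Rightarrow> bool" where
  "input_ok s \<longleftrightarrow> idx s ''flights'' 0 0 = n \<and> idx s ''slots'' 0 0 = m \<and>
     (\<forall>i j. 0 < idx s ''window'' i j \<longleftrightarrow> W i j) \<and> (\<forall>j. idx s ''capacity'' j 0 = cap j)"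

definition least_slack ::
    "(nat \<Rightarrow> nat) \<Rightarrow> (nat \<Rightarrow> real) \<Rightarrow> (nat \<times> nat) set \<Rightarrow> nat \<Rightarrow> nat \<Rightarrow> nat \<Rightarrow> real \<Rightarrow> bool" where
  "least_slack \<sigma> p X f i j v \<longleftrightarrow>
     (if f = 0 then X = {}
      else (i, j) \<in> X \<and> v = slack \<sigma> p i j \<and> (\<forall>(a, b)\<in>X. v \<le> slack \<sigma> p a b))"

abbreviation "best_in X s \<equiv>
  least_slack (schedule_of s) (price_of s) X (idx s ''found'' 0 0)
    (idx s ''best_i'' 0 0) (idx s ''best_j'' 0 0) (num s ''best'' 0 0)"

text \<open>The candidates that precede position \<open>(i, j)\<close> in the lexicographic order of
  the two nested loops.\<close>

definition scanned :: "nat \<Rightarrow> (nat \<Rightarrow> nat) \<Rightarrow> (nat \<Rightarrow> nat) \<Rightarrow> nat \<Rightarrow> nat \<Rightarrow> (nat \<times> nat) set" where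
  "scanned k \<sigma> r i j = {(a, b) \<in> candidates k \<sigma> r. a < i \<or> a = i \<and> b < j}"

abbreviation "scanned_of s \<equiv> scanned (k_of s) (schedule_of s) (rank_of s)"

lemma scanned_Suc:
  assumes "i \<le> k" "0 < r (\<sigma> i)"
  shows "scanned k \<sigma> r i (Suc j) =
     (if W i j \<and> r j = 0 then insert (i, j) (scanned k \<sigma> r i j) else scanned k \<sigma> r i j)"
  using assms by (auto simp: scanned_def candidates_def less_Suc_eq)

lemma scanned_Suc_row: "r (\<sigma> i) = 0 \<Longrightarrow> scanned k \<sigma> r (Suc i) 0 = scanned k \<sigma> r i 0"
  by (auto simp: scanned_def candidates_def less_Suc_eq)

text \<open>Windows contain no column from \<open>m\<close> on, so a row scanned up to
  \<open>m\<close> is complete.\<close>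

lemma scanned_row_end: "scanned k \<sigma> r i m = scanned k \<sigma> r (Suc i) 0"
  by (auto simp: scanned_def candidates_def less_Suc_eq dest: W_less)

lemma least_slack_keep:
  "least_slack \<sigma> p X f i j v \<Longrightarrow> 0 < f \<Longrightarrow> v \<le> slack \<sigma> p a b \<Longrightarrow> least_slack \<sigma> p (insert (a, b) X) f i j v"
  by (auto simp: least_slack_def)

lemma least_slack_new:
  "least_slack \<sigma> p X f i j v \<Longrightarrow> f = 0 \<or> slack \<sigma> p a b < v \<Longrightarrow>
    least_slack \<sigma> p (insert (a, b) X) (Suc 0) a b (slack \<sigma> p a b)"
  by (fastforce simp: least_slack_def split: if_splits)

abbreviation "scan_frame \<equiv> agree {''found'', ''i'', ''j'', ''best_i'', ''best_j''} {''value'', ''best''}"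

lemma scan_cell_correct:
  assumes "input_ok s" "idx s ''i'' 0 0 = i" "idx s ''j'' 0 0 = j" "i \<le> k_of s" "0 < rank_of s (schedule_of s i)"
    and best: "best_in (scanned_of s i j) s"
  shows "wp inp N scan_cell (\<lambda>s'. agree {''found'', ''best_i'', ''best_j''} {''value'', ''best''} s s' \<and>
            best_in (scanned_of s' i (Suc j)) s') s"
proof -
  have ok: "0 < idx s ''window'' i j \<longleftrightarrow> W i j" using assms by (auto simp: input_ok_def)
  note new = scanned_Suc[where k = "k_of s" and r = "rank_of s" and \<sigma> = "schedule_of s", OF assms(4,5)]
  \<comment> \<open>This brings the slack into the shape in which the program evaluates
    \<open>value\<close>.\<close>
  have sl: "slack (schedule_of s) (price_of s) i j =
      price_of s j + inp ''criticality'' i 0 * inp ''delay'' i j -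
      (price_of s (schedule_of s i) + inp ''criticality'' i 0 * inp ''delay'' i (schedule_of s i))"
    by (simp add: slack_def)
  note new1 = least_slack_new[OF best, of i j, unfolded sl]
  note keep1 = least_slack_keep[OF best, of i j, unfolded sl]
  show ?thesis
    unfolding scan_cell_def
    apply (intro wp_Cond wp_Seq wp_Skip wp_IAssign wp_NAssign)
    subgoal using assms(2,3) ok keep1 by (simp add: exec_defs new)
    subgoal using assms(2,3) ok new1 by (simp add: exec_defs new)
    subgoal using assms(2,3) ok best by (auto simp: agree_def new)
    done
qed

lemma input_ok_agree:
  "input_ok s \<Longrightarrow> agree A B s s' \<Longrightarrow> A \<inter> {''flights'', ''slots'', ''window'', ''capacity''} = {} \<Longrightarrow> input_ok s'"
  by (auto simp: input_ok_def agree_def)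

lemma scan_row_correct:
  assumes ok: "input_ok s" and i: "idx s ''i'' 0 0 = i" "i \<le> k_of s" "0 < rank_of s (schedule_of s i)"
    and best: "best_in (scanned_of s i 0) s"
  shows "wp inp N scan_row (\<lambda>s'. agree {''found'', ''j'', ''best_i'', ''best_j''} {''value'', ''best''} s s' \<and>
            best_in (scanned_of s' (Suc i) 0) s') s"
proof -
  let ?F = "agree {''found'', ''j'', ''best_i'', ''best_j''} {''value'', ''best''}"
  let ?I = "\<lambda>s'. ?F s s' \<and> idx s' ''j'' 0 0 \<le> m \<and> best_in (scanned_of s' i (idx s' ''j'' 0 0)) s'"
  let ?\<mu> = "\<lambda>s'. m - idx s' ''j'' 0 0"
  have step: "wp inp N (Seq scan_cell (incr ''j'')) (\<lambda>s''. ?I s'' \<and> ?\<mu> s'' < ?\<mu> s') s'"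
    if F: "?F s s'" and b: "best_in (scanned_of s' i (idx s' ''j'' 0 0)) s'" and j: "idx s' ''j'' 0 0 < m" for s'
  proof (intro wp_Seq, rule wp_mono, rule scan_cell_correct[where i = i and j = "idx s' ''j'' 0 0"])
    have e: "idx s' ''i'' = idx s ''i''" "idx s' ''k'' = idx s ''k''" "idx s' ''schedule'' = idx s ''schedule''"
      "idx s' ''rank'' = idx s ''rank''"
      using F by (simp_all add: agree_def)
    show "input_ok s'" using ok F by (rule input_ok_agree) simp
    show "idx s' ''i'' 0 0 = i" "i \<le> k_of s'" "0 < rank_of s' (schedule_of s' i)"
      using i by (simp_all add: e)
    show "best_in (scanned_of s' i (idx s' ''j'' 0 0)) s'" by (fact b)
    fix s''
    assume G: "agree {''found'', ''best_i'', ''best_j''} {''value'', ''best''} s' s'' \<and>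
      best_in (scanned_of s'' i (Suc (idx s' ''j'' 0 0))) s''"
    then have "?F s s''" using F by (auto intro: agree_trans)
    moreover have "idx s'' ''j'' = idx s' ''j''" using G by (simp add: agree_def)
    ultimately show "wp inp N (incr ''j'') (\<lambda>s''. ?I s'' \<and> ?\<mu> s'' < ?\<mu> s') s''"
      using G j by (intro wp_IAssign) (simp add: agree_store store_apply)
  qed simp
  show ?thesis
    unfolding scan_row_def
  proof (intro wp_Seq wp_IAssign, rule wp_While[where I = ?I and \<mu> = ?\<mu>])
    fix s' assume I: "?I s'"
    then have slots: "idx s' ''slots'' 0 0 = m" using ok by (simp add: agree_def input_ok_def)
    show "wp inp N (Seq scan_cell (incr ''j'')) (\<lambda>s''. ?I s'' \<and> ?\<mu> s'' < ?\<mu> s') s'"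
      if "bval inp (ILess (iget ''j'') (iget ''slots'')) s'"
      using step[of s'] I that by (simp add: slots)
    show "?F s s' \<and> best_in (scanned_of s' (Suc i) 0) s'"
      if "\<not> bval inp (ILess (iget ''j'') (iget ''slots'')) s'"
    proof -
      have "idx s' ''j'' 0 0 = m" using I that by (simp add: slots)
      then show ?thesis using I scanned_row_end by metis
    qed
  qed (use best N in \<open>simp_all add: store_apply agree_store\<close>)
qed

lemma scan_correct:
  assumes ok: "input_ok s" and k: "k_of s < n"
  shows "wp inp N scan (\<lambda>s'. scan_frame s s' \<and>
            best_in (candidates (k_of s) (schedule_of s) (rank_of s)) s') s"
proof -
  let ?I = "\<lambda>s'. scan_frame s s' \<and> idx s' ''i'' 0 0 \<le> Suc (k_of s) \<and> best_in (scanned_of s (idx s' ''i'' 0 0) 0) s'"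
  let ?\<mu> = "\<lambda>s'. Suc (k_of s) - idx s' ''i'' 0 0"
  let ?c = "ipos (ICell ''rank'' (iget ''k'') (row ''schedule'' (iget ''i'')))"
  have step: "wp inp N (Seq (Cond ?c scan_row Skip) (incr ''i'')) (\<lambda>s''. ?I s'' \<and> ?\<mu> s'' < ?\<mu> s') s'"
    if F: "scan_frame s s'" and b: "best_in (scanned_of s (idx s' ''i'' 0 0) 0) s'" and i: "idx s' ''i'' 0 0 \<le> k_of s" for s'
  proof -
    have e: "idx s' ''k'' = idx s ''k''" "idx s' ''schedule'' = idx s ''schedule''" "idx s' ''rank'' = idx s ''rank''"
      using F by (simp_all add: agree_def)
    show ?thesis
    proof (intro wp_Seq wp_Cond wp_Skip)
      assume c: "bval inp ?c s'"
      show "wp inp N scan_row (wp inp N (incr ''i'') (\<lambda>s''. ?I s'' \<and> ?\<mu> s'' < ?\<mu> s')) s'"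
      proof (rule wp_mono, rule scan_row_correct[where i = "idx s' ''i'' 0 0"])
        show "input_ok s'" using ok F by (rule input_ok_agree) simp
        show "idx s' ''i'' 0 0 \<le> k_of s'" using i by (simp add: e)
        show "0 < rank_of s' (schedule_of s' (idx s' ''i'' 0 0))" using c by simp
        show "best_in (scanned_of s' (idx s' ''i'' 0 0) 0) s'" using b by (simp add: e)
        fix s''
        assume G: "agree {''found'', ''j'', ''best_i'', ''best_j''} {''value'', ''best''} s' s'' \<and>
          best_in (scanned_of s'' (Suc (idx s' ''i'' 0 0)) 0) s''"
        then have F': "scan_frame s s''" using F by (auto intro: agree_trans)
        then have "idx s'' ''k'' = idx s ''k''" "idx s'' ''schedule'' = idx s ''schedule''" "idx s'' ''rank'' = idx s ''rank''"
          by (simp_all add: agree_def)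
        moreover have "idx s'' ''i'' = idx s' ''i''" using G by (simp add: agree_def)
        ultimately show "wp inp N (incr ''i'') (\<lambda>s''. ?I s'' \<and> ?\<mu> s'' < ?\<mu> s') s''"
          using G i F' by (intro wp_IAssign) (simp add: agree_store store_apply)
      qed simp
    next
      assume c: "\<not> bval inp ?c s'"
      then have "scanned_of s (Suc (idx s' ''i'' 0 0)) 0 = scanned_of s (idx s' ''i'' 0 0) 0"
        by (intro scanned_Suc_row) (simp add: e)
      then show "wp inp N (incr ''i'') (\<lambda>s''. ?I s'' \<and> ?\<mu> s'' < ?\<mu> s') s'"
        using F b i by (intro wp_IAssign) (simp add: agree_store store_apply)
    qed
  qed
  have all: "scanned k \<sigma> r (Suc k) 0 = candidates k \<sigma> r" for k \<sigma> r
    by (auto simp: scanned_def candidates_def)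
  show ?thesis
    unfolding scan_def
  proof (intro wp_Seq wp_IAssign, rule wp_While[where I = ?I and \<mu> = ?\<mu>])
    fix s' assume I: "?I s'"
    then have e: "idx s' ''k'' 0 0 = k_of s" by (simp add: agree_def)
    show "wp inp N (Seq (Cond ?c scan_row Skip) (incr ''i'')) (\<lambda>s''. ?I s'' \<and> ?\<mu> s'' < ?\<mu> s') s'"
      if "bval inp (ILess (iget ''i'') (IPlus (iget ''k'') (IConst 1))) s'"
      using step[of s'] I that by (simp add: e)
    show "scan_frame s s' \<and> best_in (candidates (k_of s) (schedule_of s) (rank_of s)) s'"
      if "\<not> bval inp (ILess (iget ''i'') (IPlus (iget ''k'') (IConst 1))) s'"
    proof -
      have "idx s' ''i'' 0 0 = Suc (k_of s)" using I that by (simp add: e)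
      then show ?thesis using I all by metis
    qed
  qed (use k N in \<open>simp_all add: store_apply agree_store least_slack_def scanned_def\<close>)
qed

lemma raise_prices_correct:
  assumes ok: "input_ok s"
  shows "wp inp N raise_prices (\<lambda>s'. agree {''j''} {''price''} s s' \<and>
            (\<forall>j. price_of s' j = (if j \<le> m \<and> 0 < rank_of s j then price_of s j + num s ''best'' 0 0 else price_of s j))) s"
proof -
  let ?F = "agree {''j''} {''price''}"
  \<comment> \<open>The loop has raised the reached slots below \<open>x\<close>, and no
    others.\<close>
  let ?P = "\<lambda>x s'. \<forall>j. price_of s' j = (if j < x \<and> 0 < rank_of s j then price_of s j + num s ''best'' 0 0 else price_of s j)"
  let ?I = "\<lambda>s'. ?F s s' \<and> idx s' ''j'' 0 0 \<le> Suc m \<and> ?P (idx s' ''j'' 0 0) s'"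
  let ?\<mu> = "\<lambda>s'. Suc m - idx s' ''j'' 0 0"
  show ?thesis
    unfolding raise_prices_def
  proof (intro wp_Seq wp_IAssign, rule wp_While[where I = ?I and \<mu> = ?\<mu>])
    fix s' assume I: "?I s'"
    then have e: "idx s' ''slots'' 0 0 = m" "idx s' ''k'' = idx s ''k''" "idx s' ''rank'' = idx s ''rank''"
      "num s' ''best'' = num s ''best''"
      using ok by (simp_all add: agree_def input_ok_def)
    show "?F s s' \<and> (\<forall>j. price_of s' j = (if j \<le> m \<and> 0 < rank_of s j then price_of s j + num s ''best'' 0 0 else price_of s j))"
      if "\<not> bval inp (ILess (iget ''j'') (IPlus (iget ''slots'') (IConst 1))) s'"
    proof -
      have "idx s' ''j'' 0 0 = Suc m" using I that by (simp add: e)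
      then show ?thesis using I by (simp add: less_Suc_eq_le)
    qed
    assume b: "bval inp (ILess (iget ''j'') (IPlus (iget ''slots'') (IConst 1))) s'"
    then have jm: "idx s' ''j'' 0 0 \<le> m" by (simp add: e)
    show "wp inp N (Seq (Cond (ipos (ICell ''rank'' (iget ''k'') (iget ''j'')))
               (NAssign ''price'' (iget ''j'') (IConst 0)
                  (NPlus (NCell ''price'' (iget ''j'') (IConst 0)) (nget ''best'')))
               Skip)
            (incr ''j'')) (\<lambda>s''. ?I s'' \<and> ?\<mu> s'' < ?\<mu> s') s'"
      using I jm by (intro wp_Seq wp_Cond wp_Skip wp_IAssign wp_NAssign)
        (auto simp: agree_store store_apply e less_Suc_eq)
  qed (use N in \<open>simp_all add: store_apply agree_store\<close>)
qed

section \<open>Correctness of tree growth and augmentation\<close>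

abbreviation "searching s \<equiv>
  search (k_of s) (schedule_of s) (price_of s) (load_of s) (rank_of s) (parent_of s)
    (idx s ''t'' 0 0) (idx s ''q'' 0 0)"

abbreviation "grow_frame \<equiv>
  agree {''found'', ''i'', ''j'', ''best_i'', ''best_j'', ''q'', ''rank'', ''parent'', ''t'', ''fail''}
    {''value'', ''best'', ''price''}"

text \<open>The frame only names \<open>rank\<close> as a whole, so it is stated separately that the
  rows of other flights survive; the outer loop needs the later rows to stay zero.\<close>

lemma grow_tree_correct:
  assumes ok: "input_ok s" and k: "k_of s < n" and "idx s ''fail'' 0 0 = 0" and "searching s"
  shows "wp inp N grow_tree (\<lambda>s'. grow_frame s s' \<and>
            (\<forall>k'. k' \<noteq> k_of s \<longrightarrow> idx s' ''rank'' k' = idx s ''rank'' k') \<and>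
            (if idx s' ''fail'' 0 0 = 0
             then searching s' \<and> load_of s' (idx s' ''t'' 0 0) < cap (idx s' ''t'' 0 0)
             else \<not> feasible)) s"
proof -
  let ?R = "\<lambda>s'. grow_frame s s' \<and> (\<forall>k'. k' \<noteq> k_of s \<longrightarrow> idx s' ''rank'' k' = idx s ''rank'' k')"
  let ?I = "\<lambda>s'. ?R s' \<and> (if idx s' ''fail'' 0 0 = 0 then searching s' else \<not> feasible)"
  \<comment> \<open>Each iteration reaches a new slot or fails; the \<open>Suc\<close> lets failure
    decrease the measure even when every slot has been reached.\<close>
  let ?\<mu> = "\<lambda>s'. if idx s' ''fail'' 0 0 = 0 then Suc (card {j. j < m \<and> rank_of s' j = 0}) else 0"
  show ?thesis
    unfolding grow_tree_def
  proof (rule wp_While[where I = ?I and \<mu> = ?\<mu>])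
    show "?I s" using assms by (simp add: agree_refl)
    have "card {j. j < m \<and> rank_of s j = 0} \<le> card {..<m}" by (intro card_mono) auto
    then show "?\<mu> s \<le> N" using N by simp
    fix s' assume I: "?I s'"
    then have F: "grow_frame s s'" by simp
    then have ok': "input_ok s'" by (intro input_ok_agree[OF ok]) auto
    have k': "idx s' ''k'' = idx s ''k''" using F by (simp add: agree_def)
    let ?t = "idx s' ''t'' 0 0" and ?q = "idx s' ''q'' 0 0"
    let ?b = "BAnd (BNot (ipos (iget ''fail'')))
                 (BNot (ILess (row ''load'' (iget ''t'')) (row ''capacity'' (iget ''t''))))"
    have b: "bval inp ?b s' \<longleftrightarrow> idx s' ''fail'' 0 0 = 0 \<and> \<not> load_of s' ?t < cap ?t"
      using ok' by (simp add: input_ok_def)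
    show "grow_frame s s' \<and> (\<forall>k'. k' \<noteq> k_of s \<longrightarrow> idx s' ''rank'' k' = idx s ''rank'' k') \<and> (if idx s' ''fail'' 0 0 = 0 then searching s' \<and> load_of s' ?t < cap ?t else \<not> feasible)"
      if "\<not> bval inp ?b s'"
      using I that b by (auto split: if_splits)
    assume "bval inp ?b s'"
    then have nofail: "idx s' ''fail'' 0 0 = 0" and full: "\<not> load_of s' ?t < cap ?t" using b by auto
    then have S: "searching s'" using I by simp
    let ?C = "candidates (k_of s') (schedule_of s') (rank_of s')"
    let ?Q = "\<lambda>s''. ?I s'' \<and> ?\<mu> s'' < ?\<mu> s'"
    \<comment> \<open>Ranks vanish beyond \<open>m\<close>, so the bound on \<open>j\<close> in
      \<open>raise_prices_correct\<close> is implied and the update has the form that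
      \<open>search_step\<close> expects.\<close>
    have r_le: "\<And>j. 0 < rank_of s' j \<Longrightarrow> j \<le> m" using S by (auto simp: search_def)
    have "wp inp N (Cond (ipos (iget ''found'')) extend_tree (iput ''fail'' (IConst 1))) ?Q u"
      if u: "scan_frame s' u \<and> best_in ?C u" for u
    proof (rule wp_Cond)
      have Fu: "grow_frame s u" using u by (intro agree_trans[OF F, of _ _ u]) auto
      have eu: "idx u ''k'' = idx s' ''k''" "idx u ''schedule'' = idx s' ''schedule''" "idx u ''load'' = idx s' ''load''"
        "idx u ''rank'' = idx s' ''rank''" "idx u ''parent'' = idx s' ''parent''" "num u ''price'' = num s' ''price''"
        "idx u ''t'' = idx s' ''t''" "idx u ''q'' = idx s' ''q''" "idx u ''fail'' = idx s' ''fail''"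
        using u by (simp_all add: agree_def)
      {
        assume "\<not> bval inp (ipos (iget ''found'')) u"
        then have "?C = {}" using u by (simp add: least_slack_def)
        then have "\<not> feasible" using search_no_candidates[OF S full] k k' by simp
        then show "wp inp N (iput ''fail'' (IConst 1)) ?Q u"
          using Fu I nofail by (intro wp_IAssign) (simp add: agree_store store_apply eu)
      }
      assume "bval inp (ipos (iget ''found'')) u"
      let ?i = "idx u ''best_i'' 0 0" and ?j = "idx u ''best_j'' 0 0"
      have c: "(?i, ?j) \<in> ?C" and best: "num u ''best'' 0 0 = slack (schedule_of s') (price_of s') ?i ?j"
        and least: "\<And>a b. (a, b) \<in> ?C \<Longrightarrow> slack (schedule_of s') (price_of s') ?i ?j \<le> slack (schedule_of s') (price_of s') a b"
        using u \<open>bval inp (ipos (iget ''found'')) u\<close> by (auto simp: least_slack_def eu)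
      have rj: "rank_of s' ?j = 0" "?j < m" using c W_less by (auto simp: candidates_def)
      have oku: "input_ok u" using u by (intro input_ok_agree[OF ok', of _ _ u]) auto
      let ?r = "(rank_of s')(?j := Suc ?q)"
      have "{x. x < m \<and> rank_of s' x = 0} = insert ?j {x. x < m \<and> ?r x = 0}"
        using rj by auto
      then have less: "card {x. x < m \<and> ?r x = 0} < card {x. x < m \<and> rank_of s' x = 0}"
        by simp
      show "wp inp N extend_tree ?Q u"
        unfolding extend_tree_def
      proof (rule wp_Seq, rule wp_mono[OF raise_prices_correct[OF oku]])
        fix v assume v: "agree {''j''} {''price''} u v \<and>
          (\<forall>j. price_of v j = (if j \<le> m \<and> 0 < rank_of u j then price_of u j + num u ''best'' 0 0 else price_of u j))"
        then have Fv: "grow_frame s v" by (intro agree_trans[OF Fu, of _ _ v]) auto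
        have ev: "idx v ''k'' = idx s ''k''" "idx v ''schedule'' = idx s' ''schedule''" "idx v ''load'' = idx s' ''load''"
          "idx v ''rank'' = idx s' ''rank''" "idx v ''parent'' = idx s' ''parent''"
          "idx v ''q'' = idx s' ''q''" "idx v ''fail'' = idx s' ''fail''"
          "idx v ''best_i'' = idx u ''best_i''" "idx v ''best_j'' = idx u ''best_j''"
          using v by (simp_all add: agree_def eu k')
        have p: "price_of v x = (if 0 < rank_of s' x then price_of s' x + slack (schedule_of s') (price_of s') ?i ?j else price_of s' x)" for x
          using v r_le[of x] by (auto simp: eu best)
        have S': "search (k_of s) (schedule_of s') (price_of v) (load_of s') ?r ((parent_of s')(?j := ?i)) ?j (Suc ?q)"
          using search_step[OF S full c least p] by (simp add: k')
        \<comment> \<open>The state after the four remaining assignments of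
          \<open>extend_tree\<close>, the last one outermost.\<close>
        let ?w = "v\<lparr>idx := store ''t'' 0 0 ?j (store ''parent'' (k_of s) ?j ?i
          (store ''rank'' (k_of s) ?j (Suc ?q) (store ''q'' 0 0 (Suc ?q) (idx v))))\<rparr>"
        have "grow_frame s ?w" using Fv by (simp add: agree_store)
        moreover have "\<forall>k'. k' \<noteq> k_of s \<longrightarrow> idx ?w ''rank'' k' = idx s ''rank'' k'"
          using I by (simp add: store_apply ev)
        moreover have w: "idx ?w ''k'' = idx s ''k''" "idx ?w ''schedule'' = idx s' ''schedule''" "num ?w ''price'' = num v ''price''"
          "idx ?w ''load'' = idx s' ''load''" "idx ?w ''rank'' (k_of s) = ?r" "idx ?w ''parent'' (k_of s) = (parent_of s')(?j := ?i)"
          "idx ?w ''t'' 0 0 = ?j" "idx ?w ''q'' 0 0 = Suc ?q" "idx ?w ''fail'' 0 0 = 0"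
          using nofail by (simp_all add: store_apply ev k')
        ultimately have "?Q ?w" unfolding w using S' less nofail by (simp add: k')
        then show "wp inp N (Seq (incr ''q'')
          (Seq (IAssign ''rank'' (iget ''k'') (iget ''best_j'') (iget ''q''))
          (Seq (IAssign ''parent'' (iget ''k'') (iget ''best_j'') (iget ''best_i''))
               (iput ''t'' (iget ''best_j''))))) ?Q v"
          by (intro wp_Seq wp_IAssign) (rule back_subst[where P = ?Q], assumption, simp add: store_apply ev)
      qed
    qed
    then show "wp inp N (Seq scan (Cond (ipos (iget ''found'')) extend_tree (iput ''fail'' (IConst 1)))) ?Q s'"
      using k k' by (intro wp_Seq wp_mono[OF scan_correct[OF ok']]) auto
  qed
qed

abbreviation "augment_frame \<equiv> agree {''i'', ''j'', ''schedule'', ''t'', ''load''} {}"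

lemma augment_correct:
  assumes ok: "input_ok s" and S: "searching s"
    and room: "load_of s (idx s ''t'' 0 0) < cap (idx s ''t'' 0 0)"
  shows "wp inp N augment (\<lambda>s'. augment_frame s s' \<and>
            partial_equilibrium (Suc (k_of s')) (schedule_of s') (price_of s') (load_of s')) s"
proof -
  let ?A = "\<lambda>s'. augmenting (k_of s') (schedule_of s') (price_of s') (load_of s') (rank_of s') (parent_of s') (idx s' ''t'' 0 0)"
  let ?I = "\<lambda>s'. augment_frame s s' \<and> ?A s'"
  \<comment> \<open>The rank of \<open>t\<close> drops with each move. Ranks are at most
    \<open>q\<close>, and the count of reached slots bounds \<open>q\<close> by
    \<open>Suc m\<close>, which is at most \<open>N\<close>.\<close>
  let ?\<mu> = "\<lambda>s'. rank_of s' (idx s' ''t'' 0 0)"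
  have r: "rank_of s x \<le> Suc m" for x
  proof -
    have "rank_of s x \<le> idx s ''q'' 0 0" "idx s ''q'' 0 0 + card {j. j < m \<and> rank_of s j = 0} = Suc m"
      using S unfolding search_def by blast+
    then show ?thesis by linarith
  qed
  show ?thesis
    unfolding augment_def
  proof (intro wp_Seq wp_IAssign, rule wp_While[where I = ?I and \<mu> = ?\<mu>])
    let ?s = "s\<lparr>idx := store ''load'' (ival (iget ''t'') s) (ival (IConst 0) s)
       (ival (IPlus (row ''load'' (iget ''t'')) (IConst 1)) s) (idx s)\<rparr>"
    have "load_of ?s = (load_of s)(idx s ''t'' 0 0 := Suc (load_of s (idx s ''t'' 0 0)))"
      by (auto simp: store_apply fun_eq_iff)
    then show "?I ?s" using augmenting_init[OF S room cap_m] by (simp add: agree_store store_apply)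
    show "?\<mu> ?s \<le> N" using r[of "idx s ''t'' 0 0"] N by (simp add: store_apply)
    fix s' assume I: "?I s'"
    then have slots: "idx s' ''slots'' 0 0 = m" using ok by (simp add: agree_def input_ok_def)
    show "augment_frame s s' \<and> partial_equilibrium (Suc (k_of s')) (schedule_of s') (price_of s') (load_of s')"
      if "\<not> bval inp (ILess (iget ''t'') (iget ''slots'')) s'"
      using I that augmenting_finish[OF conjunct2[OF I]] by (simp add: slots)
    assume "bval inp (ILess (iget ''t'') (iget ''slots'')) s'"
    then have t: "idx s' ''t'' 0 0 < m" by (simp add: slots)
    let ?i = "parent_of s' (idx s' ''t'' 0 0)"
    \<comment> \<open>A store into column 0 of the two-dimensional array is a plain update of the
      schedule.\<close>
    have *: "(\<lambda>i. (if i = ?i then (idx s' ''schedule'' ?i)(0 := idx s' ''t'' 0 0) else idx s' ''schedule'' i) 0) =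
       (schedule_of s')(?i := idx s' ''t'' 0 0)"
      by auto
    show "wp inp N (Seq (iput ''i'' (ICell ''parent'' (iget ''k'') (iget ''t'')))
       (Seq (iput ''j'' (row ''schedule'' (iget ''i'')))
       (Seq (IAssign ''schedule'' (iget ''i'') (IConst 0) (iget ''t''))
            (iput ''t'' (iget ''j''))))) (\<lambda>s''. ?I s'' \<and> ?\<mu> s'' < ?\<mu> s') s'"
      using I augmenting_step[OF conjunct2[OF I] t]
      by (intro wp_Seq wp_IAssign) (simp add: agree_store store_apply *)
  qed
qed

section \<open>Adding the flights one at a time\<close>

definition loop_invariant :: "state \<Rightarrow> bool" where
  "loop_invariant s \<longleftrightarrow> input_ok s \<and> k_of s \<le> Suc n \<and>
     (if idx s ''fail'' 0 0 = 0
      then k_of s \<le> n \<and> partial_equilibrium (k_of s) (schedule_of s) (price_of s) (load_of s) \<and>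
        (\<forall>k\<ge>k_of s. idx s ''rank'' k = (\<lambda>_. 0))
      else \<not> feasible)"

lemma add_flight_correct:
  assumes inv: "loop_invariant s" and k: "k_of s < n" and nofail: "idx s ''fail'' 0 0 = 0"
  shows "wp inp N add_flight (\<lambda>s'. loop_invariant s' \<and> k_of s' = Suc (k_of s)) s"
proof -
  have ok: "input_ok s" using inv by (simp add: loop_invariant_def)
  have slots: "idx s ''slots'' 0 0 = m" using ok by (simp add: input_ok_def)
  have pe: "partial_equilibrium (k_of s) (schedule_of s) (price_of s) (load_of s)"
    and rank0: "\<And>k'. k_of s \<le> k' \<Longrightarrow> idx s ''rank'' k' = (\<lambda>_. 0)"
    using inv nofail by (auto simp: loop_invariant_def)
  show ?thesis
    unfolding add_flight_def
    apply (rule wp_Seq wp_IAssign)+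
    apply (rule wp_mono)
     apply (rule grow_tree_correct)
    subgoal using ok by (simp add: input_ok_def store_apply)
    subgoal using k by (simp add: store_apply)
    subgoal using nofail by (simp add: store_apply)
    subgoal
    proof -
      have "(\<lambda>i. ((idx s ''schedule'')(k_of s := (idx s ''schedule'' (k_of s))(0 := m))) i 0) = (schedule_of s)(k_of s := m)"
        by auto
      \<comment> \<open>Row \<open>k\<close> of \<open>rank\<close> is zero except for the new entry
        of the dummy; row \<open>k\<close> of \<open>parent\<close> may hold anything, as
        \<open>\<pi>\<close> is arbitrary in \<open>search_init\<close>.\<close>
      then show ?thesis using search_init[OF pe] by (simp add: store_apply slots rank0)
    qed
    subgoal premises post for s'
    proof -
      note Fs = conjunct1[OF post]
      have kk: "idx s' ''k'' = idx s ''k''"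
        using Fs by (simp add: agree_def store_apply)
      have ok': "input_ok s'" using Fs ok by (simp add: input_ok_def agree_def store_apply)
      have ranks: "idx s' ''rank'' k' = (\<lambda>_. 0)" if "k_of s < k'" for k'
        using post that by (simp add: store_apply rank0)
      show ?thesis
      proof (intro wp_Seq wp_Cond wp_Skip)
        assume "bval inp (ipos (iget ''fail'')) s'"
        then show "wp inp N (incr ''k'') (\<lambda>s'. loop_invariant s' \<and> k_of s' = Suc (k_of s)) s'"
          using post ok' k by (intro wp_IAssign) (simp add: loop_invariant_def input_ok_def store_apply kk)
      next
        assume nf: "\<not> bval inp (ipos (iget ''fail'')) s'"
        then have S: "searching s'" "load_of s' (idx s' ''t'' 0 0) < cap (idx s' ''t'' 0 0)"
          using post by simp_all
        show "wp inp N augment (wp inp N (incr ''k'') (\<lambda>s'. loop_invariant s' \<and> k_of s' = Suc (k_of s))) s'"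
        proof (rule wp_mono[OF augment_correct[OF ok' S]])
          fix u assume u: "augment_frame s' u \<and>
            partial_equilibrium (Suc (k_of u)) (schedule_of u) (price_of u) (load_of u)"
          have eu: "idx u ''k'' = idx s ''k''" "idx u ''rank'' = idx s' ''rank''" "idx u ''fail'' = idx s' ''fail''"
            using u kk by (simp_all add: agree_def)
          have "input_ok u" using u by (intro input_ok_agree[OF ok', of _ _ u]) auto
          then show "wp inp N (incr ''k'') (\<lambda>s'. loop_invariant s' \<and> k_of s' = Suc (k_of s)) u"
            using u nf k ranks by (intro wp_IAssign) (simp add: loop_invariant_def input_ok_def store_apply eu)
        qed
      qed
    qed
    done
qed

text \<open>On exit either \<open>fail\<close> is set, which refutes \<open>feasible\<close>, or all
  \<open>n\<close> flights have been added.\<close>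

lemma landing_program_correct:
  assumes "input_ok s" "k_of s = 0" "idx s ''fail'' 0 0 = 0" "\<And>j. load_of s j = 0" "\<And>j. price_of s j = 0"
    "\<And>k j. idx s ''rank'' k j = 0"
  shows "wp inp N landing_program
    (\<lambda>s'. feasible \<longrightarrow> partial_equilibrium n (schedule_of s') (price_of s') (load_of s')) s"
  unfolding landing_program_def
proof (rule wp_While[where I = loop_invariant and \<mu> = "\<lambda>s'. Suc n - k_of s'"])
  show "loop_invariant s" using assms partial_equilibrium_0 by (simp add: loop_invariant_def fun_eq_iff)
  show "Suc n - k_of s \<le> N" using N by simp
  fix s' assume I: "loop_invariant s'"
  then have f: "idx s' ''flights'' 0 0 = n" by (simp add: loop_invariant_def input_ok_def)
  let ?b = "BAnd (ILess (iget ''k'') (iget ''flights'')) (BNot (ipos (iget ''fail'')))"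
  show "wp inp N add_flight (\<lambda>s''. loop_invariant s'' \<and> Suc n - k_of s'' < Suc n - k_of s') s'"
    if "bval inp ?b s'"
    using that f by (intro wp_mono[OF add_flight_correct[OF I]]) auto
  show "feasible \<longrightarrow> partial_equilibrium n (schedule_of s') (price_of s') (load_of s')"
    if "\<not> bval inp ?b s'"
    using that f I by (auto simp: loop_invariant_def split: if_splits)
qed

end

section \<open>Markets as program input\<close>

definition position :: "'a list \<Rightarrow> 'a \<Rightarrow> nat" where
  "position xs = the_inv_into {..<length xs} ((!) xs)"

lemma position_nth: "distinct xs \<Longrightarrow> i < length xs \<Longrightarrow> position xs (xs ! i) = i"
  unfolding position_def by (rule the_inv_into_f_f) (auto intro: inj_on_nth)

lemma position_correct:
  assumes "distinct xs" "x \<in> set xs"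
  shows "position xs x < length xs" "xs ! position xs x = x"
  using assms by (auto simp: in_set_conv_nth position_nth)

lemma card_positions:
  assumes "distinct xs"
  shows "card {i. i < length xs \<and> P (xs ! i)} = card {x \<in> set xs. P x}"
proof (rule bij_betw_same_card)
  show "bij_betw ((!) xs) {i. i < length xs \<and> P (xs ! i)} {x \<in> set xs. P x}"
    using assms by (auto simp: bij_betw_def inj_on_def nth_eq_iff_index_eq in_set_conv_nth)
qed

text \<open>The range tests mirror the input array, which is 0 outside the lists, and yield
  \<open>W_less\<close>.\<close>

definition window_at :: "('f, 's) market \<Rightarrow> 'f list \<Rightarrow> 's list \<Rightarrow> nat \<Rightarrow> nat \<Rightarrow> bool" where
  "window_at M fs ss i j \<longleftrightarrow> i < length fs \<and> j < length ss \<and> ss ! j \<in> window M (fs ! i)"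

text \<open>The default 0 agrees with the unset cells of the input and supplies \<open>cap_m\<close>
  for the dummy position.\<close>

definition capacity_at :: "('f, 's) market \<Rightarrow> 's list \<Rightarrow> nat \<Rightarrow> nat" where
  "capacity_at M ss j = (if j < length ss then capacity M (ss ! j) else 0)"

section \<open>Transfer between positions and the market\<close>

locale presented_market =
  fixes M :: "('f, 's) market" and fs ss
  assumes M: "landing_market M" and fs: "enumeration (flights M) fs" and ss: "enumeration (slots M) ss"
begin

abbreviation "n \<equiv> length fs"
abbreviation "m \<equiv> length ss"

text \<open>One \<open>N\<close> serves all loops: none makes more than \<open>n + m + 1\<close>
  iterations per entry, and the market size is at least \<open>n + m\<close>.\<close>

sublocale market_program n m "capacity_at M ss" "window_at M fs ss" "input_numbers M fs ss" "market_size M + 1"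
proof
  have "n = card (flights M)" "m = card (slots M)"
    using fs ss distinct_card[of fs] distinct_card[of ss] by (simp_all add: enumeration_def)
  then show "n + m < market_size M + 1" by (simp add: market_size_def)
qed (auto simp: window_at_def capacity_at_def)

lemma enum: "distinct fs" "set fs = flights M" "distinct ss" "set ss = slots M"
  using fs ss by (auto simp: enumeration_def)

lemma window_subset: "i \<in> flights M \<Longrightarrow> window M i \<subseteq> slots M"
  using M by (auto simp: landing_market_def)

lemma landing_program_run:
  "wp (input_numbers M fs ss) (market_size M + 1) landing_program
    (\<lambda>s'. feasible \<longrightarrow> partial_equilibrium n (schedule_of s') (price_of s') (load_of s'))
    (initial_state M fs ss)"
proof (rule landing_program_correct)
  have "0 < idx (initial_state M fs ss) ''window'' i j \<longleftrightarrow> window_at M fs ss i j" for i j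
    by (simp add: initial_state_def input_indices_def window_at_def)
  moreover have "idx (initial_state M fs ss) ''capacity'' j 0 = capacity_at M ss j" for j
    by (simp add: initial_state_def input_indices_def capacity_at_def)
  moreover have "idx (initial_state M fs ss) ''flights'' 0 0 = n" "idx (initial_state M fs ss) ''slots'' 0 0 = m"
    by (simp_all add: initial_state_def input_indices_def)
  ultimately show "input_ok (initial_state M fs ss)" by (simp add: input_ok_def)
qed (simp_all add: initial_state_def input_indices_def)

lemma feasible_if_schedule:
  assumes \<sigma>: "landing_schedule M \<sigma>"
  shows feasible
proof -
  let ?\<tau> = "\<lambda>i. position ss (\<sigma> (fs ! i))"
  have flight: "fs ! i \<in> flights M" if "i < n" for i using that enum by auto
  have W: "\<sigma> (fs ! i) \<in> window M (fs ! i)" if "i < n" for i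
    using \<sigma> flight[OF that] by (auto simp: landing_schedule_def)
  have slot: "\<sigma> (fs ! i) \<in> set ss" if "i < n" for i
    using W[OF that] window_subset[OF flight[OF that]] enum by auto
  have "load n ?\<tau> j \<le> capacity_at M ss j" if j: "j < m" for j
  proof -
    \<comment> \<open>Positions and entries of a distinct list determine each other, so the load can
      be counted over flights.\<close>
    have "{i. i < n \<and> ?\<tau> i = j} = {i. i < n \<and> \<sigma> (fs ! i) = ss ! j}"
      using position_correct[OF enum(3) slot] position_nth[OF enum(3) j] by metis
    then have "load n ?\<tau> j = card {f \<in> flights M. \<sigma> f = ss ! j}"
      using card_positions[OF enum(1), of "\<lambda>f. \<sigma> f = ss ! j"] by (simp add: load_def enum)
    then show ?thesis using \<sigma> j enum by (auto simp: landing_schedule_def capacity_at_def)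
  qed
  moreover have "window_at M fs ss i (?\<tau> i)" if "i < n" for i
    using that W[OF that] position_correct[OF enum(3) slot[OF that]] by (simp add: window_at_def)
  ultimately show ?thesis unfolding feasible_def by (intro exI[of _ ?\<tau>]) simp
qed

lemma equilibrium_if_partial_equilibrium:
  assumes pe: "partial_equilibrium n (schedule_of s) (price_of s) (load_of s)"
  shows "\<exists>\<sigma> p. outputs fs ss s \<sigma> p \<and> equilibrium M \<sigma> p"
proof -
  let ?\<sigma> = "\<lambda>f. ss ! schedule_of s (position fs f)"
  let ?p = "\<lambda>x. price_of s (position ss x)"
  have W: "window_at M fs ss i (schedule_of s i)" if "i < n" for i
    using pe that by (auto simp: partial_equilibrium_def)
  have \<sigma>: "?\<sigma> (fs ! i) = ss ! schedule_of s i" if "i < n" for i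
    using that by (simp add: position_nth enum)
  have p: "?p (ss ! j) = price_of s j" if "j < m" for j
    using that by (simp add: position_nth enum)
  have out: "outputs fs ss s ?\<sigma> ?p"
    using W \<sigma> p by (simp add: outputs_def window_at_def)
  have card: "card {f \<in> flights M. ?\<sigma> f = ss ! j} = load_of s j" if j: "j < m" for j
  proof -
    have "{i. i < n \<and> ?\<sigma> (fs ! i) = ss ! j} = {i. i < n \<and> schedule_of s i = j}"
      using \<sigma> W j enum by (auto simp: window_at_def nth_eq_iff_index_eq)
    then show ?thesis
      using card_positions[OF enum(1), of "\<lambda>f. ?\<sigma> f = ss ! j"] pe j
      by (simp add: enum partial_equilibrium_def load_def)
  qed
  have pr: "0 \<le> price_of s j" "load_of s j \<le> capacity M (ss ! j)"
    "load_of s j < capacity M (ss ! j) \<Longrightarrow> price_of s j = 0" if "j < m" for j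
    using pe that by (auto simp: partial_equilibrium_def prices_ok_def capacity_at_def)
  \<comment> \<open>The program's cost is the true one only inside windows, since delays elsewhere
    are presented as 0.\<close>
  have cost: "total_cost M ?p (fs ! i) (ss ! j) =
      price_of s j + input_numbers M fs ss ''criticality'' i 0 * input_numbers M fs ss ''delay'' i j"
    if "window_at M fs ss i j" for i j
    using that p by (simp add: window_at_def total_cost_def input_numbers_def)
  have min: "total_cost M ?p (fs ! i) (?\<sigma> (fs ! i)) = Min (total_cost M ?p (fs ! i) ` window M (fs ! i))"
    if i: "i < n" for i
  proof (rule Min_eqI[symmetric])
    have sub: "window M (fs ! i) \<subseteq> set ss" using window_subset i enum nth_mem by metis
    then show "finite (total_cost M ?p (fs ! i) ` window M (fs ! i))" by (auto intro: finite_subset)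
    show "total_cost M ?p (fs ! i) (?\<sigma> (fs ! i)) \<in> total_cost M ?p (fs ! i) ` window M (fs ! i)"
      using W[OF i] \<sigma>[OF i] by (auto simp: window_at_def)
    fix y assume "y \<in> total_cost M ?p (fs ! i) ` window M (fs ! i)"
    then obtain x where x: "x \<in> window M (fs ! i)" "y = total_cost M ?p (fs ! i) x" by auto
    with sub obtain j where j: "j < m" "x = ss ! j" by (metis in_set_conv_nth subsetD)
    with x i have Wj: "window_at M fs ss i j" by (simp add: window_at_def)
    \<comment> \<open>Nonnegative slack over the whole window says precisely that the assigned slot
      attains the minimum.\<close>
    then have "0 \<le> slack (schedule_of s) (price_of s) i j"
      using pe i by (auto simp: partial_equilibrium_def)
    then show "total_cost M ?p (fs ! i) (?\<sigma> (fs ! i)) \<le> y"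
      unfolding x(2) j(2) \<sigma>[OF i] cost[OF Wj] cost[OF W[OF i]] slack_def by simp
  qed
  have flight: "\<exists>i<n. f = fs ! i" if "f \<in> flights M" for f
    using that enum by (metis in_set_conv_nth)
  have slot: "\<exists>j<m. x = ss ! j" if "x \<in> slots M" for x
    using that enum by (metis in_set_conv_nth)
  have "landing_schedule M ?\<sigma>"
    unfolding landing_schedule_def
  proof (intro conjI ballI)
    fix f assume "f \<in> flights M"
    then obtain i where "i < n" "f = fs ! i" using flight by blast
    then show "?\<sigma> f \<in> window M f" using W \<sigma> by (simp add: window_at_def)
  next
    fix x assume "x \<in> slots M"
    then obtain j where "j < m" "x = ss ! j" using slot by blast
    then show "card {f \<in> flights M. ?\<sigma> f = x} \<le> capacity M x" using card pr by simp
  qed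
  moreover have "landing_prices M ?p"
    unfolding landing_prices_def
  proof
    fix x assume "x \<in> slots M"
    then obtain j where "j < m" "x = ss ! j" using slot by blast
    then show "0 \<le> ?p x" using p pr by simp
  qed
  moreover have "\<forall>f\<in>flights M. total_cost M ?p f (?\<sigma> f) = Min (total_cost M ?p f ` window M f)"
    using flight min by blast
  moreover have "\<forall>x\<in>slots M. card {f \<in> flights M. ?\<sigma> f = x} < capacity M x \<longrightarrow> ?p x = 0"
  proof (intro ballI impI)
    fix x assume "x \<in> slots M" and less: "card {f \<in> flights M. ?\<sigma> f = x} < capacity M x"
    then obtain j where "j < m" "x = ss ! j" using slot by blast
    then show "?p x = 0" using less card p pr by simp
  qed
  ultimately have "equilibrium M ?\<sigma> ?p" by (simp add: equilibrium_def)
  with out show ?thesis by blast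
qed

end

theorem theorem2:
  "\<exists>(P :: com) (C :: nat) (k :: nat).
     \<forall>(M :: ('f, 's) market) fs ss.
       landing_market M \<longrightarrow> enumeration (flights M) fs \<longrightarrow> enumeration (slots M) ss \<longrightarrow>
       (\<exists>t s. exec (input_numbers M fs ss) P (initial_state M fs ss) t s \<and>
              t \<le> C * (market_size M + 1) ^ k \<and>
              ((\<exists>\<sigma>. landing_schedule M \<sigma>) \<longrightarrow>
                 (\<exists>\<sigma> p. outputs fs ss s \<sigma> p \<and> equilibrium M \<sigma> p)))"
proof -
  obtain C k where poly: "\<And>N. time_bound N landing_program \<le> C * (N + 1) ^ k"
    using time_bound_polynomial by blast
  show ?thesis
  \<comment> \<open>The loop bound is \<open>market_size M + 1\<close>, so the polynomial is taken
    at \<open>market_size M + 2\<close>, which is at most twice \<open>market_size M + 1\<close>;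
    this gives the factor \<open>2 ^ k\<close>.\<close>
  proof (rule exI[of _ landing_program], rule exI[of _ "C * 2 ^ k"], rule exI[of _ k], intro allI impI)
    fix M :: "('f, 's) market" and fs ss
    assume "landing_market M" "enumeration (flights M) fs" "enumeration (slots M) ss"
    then interpret presented_market M fs ss by unfold_locales
    obtain t s where run: "exec (input_numbers M fs ss) landing_program (initial_state M fs ss) t s"
      and t: "t \<le> time_bound (market_size M + 1) landing_program"
      and pe: "feasible \<longrightarrow> partial_equilibrium n (schedule_of s) (price_of s) (load_of s)"
      using landing_program_run by (auto simp: wp_def)
    have "(market_size M + 1 + 1) ^ k \<le> (2 * (market_size M + 1)) ^ k" by (intro power_mono) auto
    also have "\<dots> = 2 ^ k * (market_size M + 1) ^ k" by (rule power_mult_distrib)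
    finally have "C * (market_size M + 1 + 1) ^ k \<le> C * 2 ^ k * (market_size M + 1) ^ k"
      unfolding mult.assoc by (rule mult_le_mono2)
    then have "t \<le> C * 2 ^ k * (market_size M + 1) ^ k"
      using t poly[of "market_size M + 1"] by linarith
    with run pe show "\<exists>t s. exec (input_numbers M fs ss) landing_program (initial_state M fs ss) t s \<and>
        t \<le> C * 2 ^ k * (market_size M + 1) ^ k \<and>
        ((\<exists>\<sigma>. landing_schedule M \<sigma>) \<longrightarrow> (\<exists>\<sigma> p. outputs fs ss s \<sigma> p \<and> equilibrium M \<sigma> p))"
      using feasible_if_schedule equilibrium_if_partial_equilibrium by blast
  qed
qed

end
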